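(* Let $X$ be a Banach space, $\omega\ge0$, $v:\mathbb{R}\to[1,\infty)$ strongly admissible, and let $A$ be an operator on $X$ with a bounded $\mathrm{W}^2_v(S_\omega)$-calculus $\Psi$. Suppose that $f\in\mathrm{H\ddot{o}r}^2_v(S_\omega)$ and that $(f_n)_n$ is a sequence in $\mathrm{H\ddot{o}r}^2_v(S_\omega)$ such that \begin{enumerate} \item there is an ample set $\mathcal D\subseteq\mathrm{H}^\infty_0[\overline{S_\omega}]$ with $\|\psi(f_n-f)\|_{\mathrm{W}^2_v(S_\omega)}\to0$ as $n\to\infty$ for all $\psi\in\mathcal D$; \item each $f_n(A)$ is bounded and $\sup_{n\in\mathbb{N}}\|f_n(A)\|<\infty$. \end{enumerate} Then $f(A)\in\mathcal L(X)$ and $f_n(A)\to f(A)$ strongly on $X$.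
   Context: $S_\omega=\{|\operatorname{Im}z|<\omega\}$ ($S_0=\mathbb{R}$); $\tau_tf=f(\cdot-t)$; $\hat g(t)=\int g(s)e^{-\mathrm{i}st}ds$. A measurable $v:\mathbb{R}\to(0,\infty)$ is admissible if $v\ge1$ and $\sup_{s,t}\frac{v(s+t)}{v(s)+v(t)}<\infty$, strongly admissible if also $1/v\in L^2(\mathbb{R})$. $\mathrm{W}^2_v(S_\omega)=\{\hat g:ve^{\omega|\cdot|}g\in L^2\}$, norm $\|ve^{\omega|\cdot|}g\|_2$ (a Banach algebra of functions on $S_\omega$ for strongly admissible $v$). With $G(z)=e^{-z^2}$, $\mathrm{H\ddot{o}r}^2_v(S_\omega)$ consists of functions $f$ on $S_\omega$ with $\sup_t\|\tau_tG\cdot f\|_{\mathrm{W}^2_v(S_\omega)}<\infty$; for such $f$ one has $Gf\in\mathrm{W}^2_v(S_\omega)$. $\mathrm{H}^\infty_0(S_\theta)$: holomorphic $f$ on $S_\theta$ with $|f(z)|\lesssim(1+|\operatorname{Re}z|)^{-\alpha}$ for all $\alpha>0$; $\mathrm{H}^\infty_0[\overline{S_\omega}]=\bigcup_{\theta>\omega}\mathrm{H}^\infty_0(S_\theta)$. $A$ has a bounded $\mathrm{W}^2_v(S_\omega)$-calculus if there is a bounded algebra homomorphism $\Psi:\mathrm{W}^2_v(S_\omega)\to\mathcal L(X)$ with $\Psi((\lambda-z)^{-1})=R(\lambda,A)$ for $\lambda\notin\overline{S_\omega}$; then $A$ is of strip type $\omega$ and $\psi(A):=\Psi(\psi)$ for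 $\psi\in\mathrm{W}^2_v(S_\omega)$ (this agrees with the holomorphic calculus). For $f\in\mathrm{H\ddot{o}r}^2_v(S_\omega)$, $f(A)$ is the closed operator $\Psi(G)^{-1}\Psi(Gf)$ ($\Psi(G)$ is injective). A set $\mathcal D$ of such functions is ample if the closed linear span of $\bigcup_{\psi\in\mathcal D}\operatorname{ran}\psi(A)$ is $X$. *)

theory Defs
  imports "HOL-Analysis.Analysis"
begin

text \<open>The library has no class of complex normed spaces; we introduce complex
  scalar multiplication on a (real) Banach space, compatible with the real one
  and with the norm.\<close>

class cbanach = banach +
  fixes cscale :: "complex \<Rightarrow> 'a \<Rightarrow> 'a"
  assumes cscale_add_right: "cscale c (x + y) = cscale c x + cscale c y"
    and cscale_add_left: "cscale (a + b) x = cscale a x + cscale b x"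
    and cscale_cscale: "cscale a (cscale b x) = cscale (a * b) x"
    and cscale_of_real: "cscale (complex_of_real r) x = r *\<^sub>R x"
    and norm_cscale: "norm (cscale c x) = cmod c * norm x"

definition bounded_op :: "('x::cbanach \<Rightarrow> 'x) \<Rightarrow> bool" where
  "bounded_op T \<longleftrightarrow> bounded_linear T \<and> (\<forall>c x. T (cscale c x) = cscale c (T x))"

definition strip :: "real \<Rightarrow> complex set" where
  "strip \<omega> = (if \<omega> = 0 then {z. Im z = 0} else {z. \<bar>Im z\<bar> < \<omega>})"

text \<open>Functions on S_omega are represented by functions on C vanishing off S_omega.\<close>
definition restr :: "real \<Rightarrow> (complex \<Rightarrow> complex) \<Rightarrow> complex \<Rightarrow> complex" where
  "restr \<omega> f = (\<lambda>z. if z \<in> strip \<omega> then f z else 0)"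

definition admissible :: "(real \<Rightarrow> real) \<Rightarrow> bool" where
  "admissible v \<longleftrightarrow> v \<in> borel_measurable lborel \<and> (\<forall>s. 1 \<le> v s) \<and>
     (\<exists>C. \<forall>s t. v (s + t) \<le> C * (v s + v t))"

definition strongly_admissible :: "(real \<Rightarrow> real) \<Rightarrow> bool" where
  "strongly_admissible v \<longleftrightarrow> admissible v \<and> integrable lborel (\<lambda>s. (1 / v s)\<^sup>2)"

definition fourier :: "(real \<Rightarrow> complex) \<Rightarrow> complex \<Rightarrow> complex" where
  "fourier g z = (\<integral>s. g s * exp (- \<i> * complex_of_real s * z) \<partial>lborel)"

definition wt :: "(real \<Rightarrow> real) \<Rightarrow> real \<Rightarrow> (real \<Rightarrow> complex) \<Rightarrow> real \<Rightarrow> complex" where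
  "wt v \<omega> g = (\<lambda>s. complex_of_real (v s * exp (\<omega> * \<bar>s\<bar>)) * g s)"

definition W_rep :: "(real \<Rightarrow> real) \<Rightarrow> real \<Rightarrow> (complex \<Rightarrow> complex) \<Rightarrow> (real \<Rightarrow> complex) \<Rightarrow> bool" where
  "W_rep v \<omega> f g \<longleftrightarrow> g \<in> borel_measurable lborel \<and>
     integrable lborel (\<lambda>s. (cmod (wt v \<omega> g s))\<^sup>2) \<and>
     (\<forall>z \<in> strip \<omega>. f z = fourier g z)"

definition W :: "(real \<Rightarrow> real) \<Rightarrow> real \<Rightarrow> (complex \<Rightarrow> complex) set" where
  "W v \<omega> = {f. (\<forall>z. z \<notin> strip \<omega> \<longrightarrow> f z = 0) \<and> (\<exists>g. W_rep v \<omega> f g)}"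

text \<open>Norm ||v e^{omega|.|} g||_2 (g is unique a.e., we take the infimum over representatives).\<close>
definition Wnorm :: "(real \<Rightarrow> real) \<Rightarrow> real \<Rightarrow> (complex \<Rightarrow> complex) \<Rightarrow> real" where
  "Wnorm v \<omega> f = Inf {sqrt (\<integral>s. (cmod (wt v \<omega> g s))\<^sup>2 \<partial>lborel) | g. W_rep v \<omega> f g}"

definition gauss :: "complex \<Rightarrow> complex" where
  "gauss z = exp (- (z\<^sup>2))"

definition shift :: "real \<Rightarrow> (complex \<Rightarrow> complex) \<Rightarrow> complex \<Rightarrow> complex" where
  "shift t f = (\<lambda>z. f (z - complex_of_real t))"

definition Hor :: "(real \<Rightarrow> real) \<Rightarrow> real \<Rightarrow> (complex \<Rightarrow> complex) set" where
  "Hor v \<omega> = {f. (\<forall>t. restr \<omega> (\<lambda>z. shift t gauss z * f z) \<in> W v \<omega>) \<and>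
      (\<exists>C. \<forall>t. Wnorm v \<omega> (restr \<omega> (\<lambda>z. shift t gauss z * f z)) \<le> C)}"

definition Hinf0 :: "real \<Rightarrow> (complex \<Rightarrow> complex) set" where
  "Hinf0 \<theta> = {f. f holomorphic_on strip \<theta> \<and>
     (\<forall>\<alpha>>0. \<exists>C. \<forall>z\<in>strip \<theta>. cmod (f z) \<le> C * (1 + \<bar>Re z\<bar>) powr (- \<alpha>))}"

definition Hinf0_closed :: "real \<Rightarrow> (complex \<Rightarrow> complex) set" where
  "Hinf0_closed \<omega> = (\<Union>\<theta>\<in>{\<theta>. \<theta> > \<omega>}. Hinf0 \<theta>)"

definition lin_op :: "'x::cbanach set \<Rightarrow> ('x \<Rightarrow> 'x) \<Rightarrow> bool" where
  "lin_op DA A \<longleftrightarrow> 0 \<in> DA \<and> (\<forall>x\<in>DA. \<forall>y\<in>DA. x + y \<in> DA \<and> A (x + y) = A x + A y) \<and>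
     (\<forall>c. \<forall>x\<in>DA. cscale c x \<in> DA \<and> A (cscale c x) = cscale c (A x))"

definition is_resolvent :: "'x::cbanach set \<Rightarrow> ('x \<Rightarrow> 'x) \<Rightarrow> complex \<Rightarrow> ('x \<Rightarrow> 'x) \<Rightarrow> bool" where
  "is_resolvent DA A lam R \<longleftrightarrow> bounded_op R \<and>
     (\<forall>x. R x \<in> DA \<and> cscale lam (R x) - A (R x) = x) \<and>
     (\<forall>y\<in>DA. R (cscale lam y - A y) = y)"

definition W_calculus ::
  "(real \<Rightarrow> real) \<Rightarrow> real \<Rightarrow> 'x::cbanach set \<Rightarrow> ('x \<Rightarrow> 'x) \<Rightarrow> ((complex \<Rightarrow> complex) \<Rightarrow> 'x \<Rightarrow> 'x) \<Rightarrow> bool" where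
  "W_calculus v \<omega> DA A \<Psi> \<longleftrightarrow>
     (\<forall>f\<in>W v \<omega>. bounded_op (\<Psi> f)) \<and>
     (\<forall>f\<in>W v \<omega>. \<forall>g\<in>W v \<omega>. \<Psi> (\<lambda>z. f z + g z) = (\<lambda>x. \<Psi> f x + \<Psi> g x)) \<and>
     (\<forall>c. \<forall>f\<in>W v \<omega>. \<Psi> (\<lambda>z. c * f z) = (\<lambda>x. cscale c (\<Psi> f x))) \<and>
     (\<forall>f\<in>W v \<omega>. \<forall>g\<in>W v \<omega>. \<Psi> (\<lambda>z. f z * g z) = \<Psi> f \<circ> \<Psi> g) \<and>
     (\<exists>C. \<forall>f\<in>W v \<omega>. onorm (\<Psi> f) \<le> C * Wnorm v \<omega> f) \<and>
     (\<forall>lam. \<bar>Im lam\<bar> > \<omega> \<longrightarrow> is_resolvent DA A lam (\<Psi> (restr \<omega> (\<lambda>z. 1 / (lam - z)))))"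

text \<open>f(A) = Psi(G)^{-1} Psi(G f): its domain and its action.\<close>
definition fA_dom :: "real \<Rightarrow> ((complex \<Rightarrow> complex) \<Rightarrow> 'x \<Rightarrow> 'x) \<Rightarrow> (complex \<Rightarrow> complex) \<Rightarrow> 'x set" where
  "fA_dom \<omega> \<Psi> f = {x. \<exists>y. \<Psi> (restr \<omega> gauss) y = \<Psi> (restr \<omega> (\<lambda>z. gauss z * f z)) x}"

definition fA :: "real \<Rightarrow> ((complex \<Rightarrow> complex) \<Rightarrow> 'x \<Rightarrow> 'x) \<Rightarrow> (complex \<Rightarrow> complex) \<Rightarrow> 'x \<Rightarrow> 'x" where
  "fA \<omega> \<Psi> f x = (THE y. \<Psi> (restr \<omega> gauss) y = \<Psi> (restr \<omega> (\<lambda>z. gauss z * f z)) x)"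

text \<open>psi(A) for psi defined on a larger strip: apply Psi to the restriction to S_omega.\<close>
definition ample ::
  "real \<Rightarrow> ((complex \<Rightarrow> complex) \<Rightarrow> 'x::cbanach \<Rightarrow> 'x) \<Rightarrow> (complex \<Rightarrow> complex) set \<Rightarrow> bool" where
  "ample \<omega> \<Psi> D \<longleftrightarrow> closure (span (\<Union>\<psi>\<in>D. range (\<Psi> (restr \<omega> \<psi>)))) = UNIV"

end

theory Submission
  imports Defs "HOL-Probability.Sinc_Integral" "HOL-Complex_Analysis.Complex_Analysis" "HOL-Real_Asymp.Real_Asymp"
begin

text \<open>
  Write \<open>G\<close> for the Gaussian and \<open>T\<^sub>n\<close> for \<open>f\<^sub>n(A)\<close>. For \<open>\<psi>\<close> in the ample set, multiplicativity of \<open>\<Psi>\<close> gives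
  \<open>\<Psi>(G) (T\<^sub>n \<Psi>(\<psi>) - \<Psi>(\<psi> (f\<^sub>n - f))) = \<Psi>(G f) \<Psi>(\<psi>)\<close>. As \<open>\<Psi>(G)\<close> is injective, the operator in
  brackets does not depend on \<open>n\<close>, and \<open>\<Psi>(\<psi> (f\<^sub>n - f))\<close> tends to 0; so \<open>T\<^sub>n\<close> converges strongly on the
  range of \<open>\<Psi>(\<psi>)\<close>, hence everywhere by uniform boundedness and density.

  Two facts are behind this. First, holomorphic functions on a larger strip that decay like
  \<open>1 / (1 + (Re z)\<^sup>2)\<close> lie in the algebra, with norm controlled by their integrals along two lines: insert
  \<open>1 / (w - z) = -i \<integral> e\<^sup>i\<^sup>s\<^sup>(\<^sup>w\<^sup>-\<^sup>z\<^sup>) ds\<close> (over \<open>s > 0\<close>) and its mirror image into Cauchy's formula on the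
  strip, and use that an admissible weight grows subexponentially. Second, \<open>\<Psi>(G)\<close> is injective.
\<close>

subsection \<open>Growth of admissible weights\<close>

text \<open>A Steinhaus-type argument: some sublevel set E of v inside [-2L, 2L] has measure above
  3L. For |s| \<le> L both E and s - E lie in [-3L, 3L], which has length 6L, so they meet; a common
  point t gives v(s) \<le> C (v(t) + v(s - t)).\<close>

lemma admissible_bounded_on_interval:
  assumes v: "admissible v"
  shows "\<exists>K. \<forall>s. \<bar>s\<bar> \<le> L \<longrightarrow> v s \<le> K"
proof (cases "L > 0")
  case False
  have "v s \<le> v 0" if "\<bar>s\<bar> \<le> L" for s
    using that False by (cases "s = 0") auto
  then show ?thesis by blast
next
  case L: True
  have vm [measurable]: "v \<in> borel_measurable borel" and v1: "\<And>s. 1 \<le> v s"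
    using v by (auto simp: admissible_def)
  obtain C where C: "\<And>s t. v (s + t) \<le> C * (v s + v t)"
    using v by (auto simp: admissible_def)
  have C0: "C \<ge> 0"
  proof (rule ccontr)
    assume "\<not> C \<ge> 0"
    then have "C * (v 0 + v 0) < 0" using v1[of 0] by (intro mult_neg_pos) auto
    then show False using C[of 0 0] v1[of "0 + 0"] by linarith
  qed
  define E where "E M = {t \<in> {-(2*L)..2*L}. v t \<le> real M}" for M :: nat
  have [measurable, simp]: "E M \<in> sets borel" for M
    unfolding E_def by measurable
  have "incseq E" by (auto simp: incseq_def E_def)
  moreover have "(\<Union>M. E M) = {-(2*L)..2*L}"
    using real_arch_simple by (fastforce simp: E_def)
  ultimately have "(\<lambda>M. measure lborel (E M)) \<longlonglongrightarrow> measure lborel {-(2*L)..2*L}"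
    using Lim_measure_incseq[of E lborel] L by (auto simp: image_subset_iff)
  then have "eventually (\<lambda>M. measure lborel (E M) > 3 * L) sequentially"
    using L by (intro order_tendstoD(1)) auto
  then obtain M where M: "measure lborel (E M) > 3 * L"
    by (auto simp: eventually_sequentially)
  have iE: "integrable lborel (indicat_real (E M))"
  proof -
    have "emeasure lborel (E M) \<le> emeasure lborel {-(2*L)..2*L}"
      by (rule emeasure_mono) (auto simp: E_def)
    also have "\<dots> < \<infinity>" using L by simp
    finally show ?thesis by simp
  qed
  have "v s \<le> C * (2 * real M)" if s: "\<bar>s\<bar> \<le> L" for s
  proof -
    have "\<exists>t. t \<in> E M \<and> s - t \<in> E M"
    proof (rule ccontr)
      assume no: "\<not> ?thesis"
      have i2: "integrable lborel (\<lambda>t. indicat_real (E M) (s + (-1) * t))"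
        using iE by (rule lborel_integrable_real_affine) simp
      have eq: "(\<integral>t. indicat_real (E M) t \<partial>lborel) = (\<integral>t. indicat_real (E M) (s + (-1) * t) \<partial>lborel)"
        using lborel_integral_real_affine[of "-1" "indicat_real (E M)" s] by simp
      have "2 * (\<integral>t. indicat_real (E M) t \<partial>lborel)
          = (\<integral>t. indicat_real (E M) t + indicat_real (E M) (s + (-1) * t) \<partial>lborel)"
        using iE i2 eq by simp
      also have "\<dots> \<le> (\<integral>t. indicat_real {-(3*L)..3*L} t \<partial>lborel)"
      proof (rule integral_mono)
        fix t
        show "indicat_real (E M) t + indicat_real (E M) (s + - 1 * t) \<le> indicat_real {-(3*L)..3*L} t"
          using no s L by (auto simp: indicator_def E_def)
      qed (use iE i2 L in auto)
      finally show False using M L by simp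
    qed
    then obtain t where t: "v t \<le> M" "v (s - t) \<le> M" by (auto simp: E_def)
    have "v s \<le> C * (v t + v (s - t))" using C[of t "s - t"] by simp
    also have "\<dots> \<le> C * (2 * real M)" using t C0 by (intro mult_left_mono) auto
    finally show ?thesis .
  qed
  then show ?thesis by blast
qed

text \<open>Halving the argument costs a factor 2C. For large |s| this is paid for by the step from
  exp (\<epsilon> |s| / 2) to exp (\<epsilon> |s|), and near 0 the weight is bounded.\<close>

lemma admissible_subexponential:
  assumes v: "admissible v" and e: "\<epsilon> > 0"
  shows "\<exists>K>0. \<forall>s. v s \<le> K * exp (\<epsilon> * \<bar>s\<bar>)"
proof -
  have v1: "\<And>s. 1 \<le> v s"
    using v by (auto simp: admissible_def)
  obtain C0 where C0: "\<And>s t. v (s + t) \<le> C0 * (v s + v t)"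
    using v by (auto simp: admissible_def)
  \<comment> \<open>The maximum with 1 keeps 2C positive, so that exp (ln (2C)) = 2C.\<close>
  define C where "C = max C0 1"
  have C: "v (s + t) \<le> C * (v s + v t)" for s t
    by (rule order_trans[OF C0]) (use v1[of s] v1[of t] in \<open>auto simp: C_def intro!: mult_right_mono\<close>)
  have C1: "C \<ge> 1" by (simp add: C_def)
  \<comment> \<open>From here on 2C \<le> exp (\<epsilon> |s| / 2) whenever |s| \<ge> L, which
    covers the cost of one halving.\<close>
  define L where "L = max 1 (2 * ln (2 * C) / \<epsilon>)"
  have L: "L \<ge> 1" "ln (2 * C) \<le> \<epsilon> * L / 2"
    using e by (auto simp: L_def field_simps max_def)
  obtain K where K: "\<And>s. \<bar>s\<bar> \<le> L \<Longrightarrow> v s \<le> K"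
    using admissible_bounded_on_interval[OF v, of L] by blast
  have K1: "K \<ge> 1" using K[of 0] v1[of 0] L by auto
  have *: "\<bar>s\<bar> \<le> L * 2 ^ n \<Longrightarrow> v s \<le> K * exp (\<epsilon> * \<bar>s\<bar>)" for n s
  proof (induction n arbitrary: s)
    case 0
    have "K * 1 \<le> K * exp (\<epsilon> * \<bar>s\<bar>)" using K1 e by (intro mult_left_mono) auto
    then show ?case using K[of s] 0 by simp
  next
    case (Suc n)
    show ?case
    proof (cases "\<bar>s\<bar> \<le> L")
      case True
      have "K * 1 \<le> K * exp (\<epsilon> * \<bar>s\<bar>)" using K1 e by (intro mult_left_mono) auto
      then show ?thesis using K[of s] True by simp
    next
      case False
      have "v s \<le> C * (v (s/2) + v (s/2))" using C[of "s/2" "s/2"] by simp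
      also have "\<dots> = 2 * C * v (s/2)" by simp
      also have "\<dots> \<le> 2 * C * (K * exp (\<epsilon> * \<bar>s/2\<bar>))"
        using C1 Suc by (intro mult_left_mono Suc.IH) auto
      also have "\<dots> = K * (exp (ln (2 * C)) * exp (\<epsilon> * \<bar>s/2\<bar>))" using C1 by simp
      also have "\<dots> = K * exp (ln (2 * C) + \<epsilon> * \<bar>s\<bar> / 2)" by (simp add: exp_add)
      also have "\<dots> \<le> K * exp (\<epsilon> * \<bar>s\<bar>)"
      proof -
        have "\<epsilon> * L \<le> \<epsilon> * \<bar>s\<bar>" using False e by simp
        then show ?thesis using L K1 by (intro mult_left_mono) auto
      qed
      finally show ?thesis .
    qed
  qed
  have "v s \<le> K * exp (\<epsilon> * \<bar>s\<bar>)" for s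
  proof -
    obtain n where "\<bar>s\<bar> < 2 ^ n" using real_arch_pow[of 2 "\<bar>s\<bar>"] by auto
    also have "(2::real) ^ n \<le> L * 2 ^ n" using L by simp
    finally show ?thesis using *[of s n] by simp
  qed
  then show ?thesis using K1 by (intro exI[of _ K]) auto
qed

subsection \<open>Cauchy's formula on a strip\<close>

text \<open>Translation by \<open>c\<close> moves the segment onto the real axis, where a contour
  integral is an integral over an interval.\<close>

lemma has_contour_integral_horizontal_iff:
  assumes "a < b"
  shows "(f has_contour_integral I) (linepath (of_real a + c) (of_real b + c)) \<longleftrightarrow>
         ((\<lambda>x. f (of_real x + c)) has_integral I) {a..b}"
proof -
  have "(f has_contour_integral I) (linepath (of_real a + c) (of_real b + c)) \<longleftrightarrow>
        ((\<lambda>w. f (w + c)) has_contour_integral I) (linepath (of_real a) (of_real b))"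
    unfolding has_contour_integral_linepath by (simp add: linepath_def algebra_simps)
  also have "\<dots> \<longleftrightarrow> ((\<lambda>x. f (of_real x + c)) has_integral I) {a..b}"
    using has_contour_integral_linepath_Reals_iff[of "of_real a" "of_real b" "\<lambda>w. f (w + c)" I] assms
    by auto
  finally show ?thesis .
qed

text \<open>Dominated convergence with majorant |H|. This connects the gauge integrals over [-n, n]
  that contour integration produces with the Lebesgue integral over the whole line.\<close>

lemma integral_symmetric_interval_tendsto:
  fixes H :: "real \<Rightarrow> complex"
  assumes H: "integrable lborel H"
  shows "(\<lambda>n. integral {-real n..real n} H) \<longlonglongrightarrow> integral\<^sup>L lborel H"
proof -
  have [measurable]: "H \<in> borel_measurable borel" using H by auto
  have "(\<lambda>n. \<integral>x. indicator {-real n..real n} x *\<^sub>R H x \<partial>lborel) \<longlonglongrightarrow> integral\<^sup>L lborel H"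
  proof (rule integral_dominated_convergence[where w = "\<lambda>x. norm (H x)"])
    show "AE x in lborel. (\<lambda>n. indicator {-real n..real n} x *\<^sub>R H x) \<longlonglongrightarrow> H x"
    proof (rule AE_I2)
      fix x :: real
      obtain N :: nat where N: "\<bar>x\<bar> \<le> real N" using real_arch_simple by blast
      have "\<forall>\<^sub>F n in sequentially. indicator {-real n..real n} x *\<^sub>R H x = H x"
        using eventually_ge_at_top[of N] by eventually_elim (use N in \<open>auto simp: indicator_def\<close>)
      then show "(\<lambda>n. indicator {-real n..real n} x *\<^sub>R H x) \<longlonglongrightarrow> H x"
        by (rule tendsto_eventually)
    qed
  qed (use H in \<open>auto simp: indicator_def\<close>)
  moreover have "(\<integral>x. indicator {-real n..real n} x *\<^sub>R H x \<partial>lborel) = integral {-real n..real n} H" for n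
  proof -
    have "set_integrable lborel {-real n..real n} H"
      using H unfolding set_integrable_def by (intro integrable_mult_indicator) auto
    from set_borel_integral_eq_integral(2)[OF this] show ?thesis
      by (simp add: set_lebesgue_integral_def)
  qed
  ultimately show ?thesis by simp
qed

lemma integrable_inverse_1_plus_sq: "integrable lborel (\<lambda>x::real. 1 / (1 + x\<^sup>2))"
  using integrable_inverse_1_plus_square
  by (simp add: set_integrable_def einterval_def inverse_eq_divide)

section \<open>Strips and integrability along horizontal lines\<close>

lemma strip_pos: "\<theta> > 0 \<Longrightarrow> strip \<theta> = {z. \<bar>Im z\<bar> < \<theta>}"
  by (simp add: strip_def)

lemma open_strip: "\<theta> > 0 \<Longrightarrow> open (strip \<theta>)"
  unfolding strip_pos by (intro open_Collect_less continuous_intros)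

lemma convex_strip: "\<theta> > 0 \<Longrightarrow> convex (strip \<theta>)"
proof -
  assume "\<theta> > 0"
  moreover have "{z. \<bar>Im z\<bar> < \<theta>} = Im -` {-\<theta><..<\<theta>}" by auto
  moreover have "linear Im" by (simp add: bounded_linear_Im bounded_linear.linear)
  ultimately show ?thesis
    by (simp add: strip_pos convex_linear_vimage)
qed

lemma continuous_on_line:
  assumes "\<theta> > 0" "\<psi> holomorphic_on strip \<theta>" "\<bar>y\<bar> < \<theta>"
  shows "continuous_on UNIV (\<lambda>x. \<psi> (of_real x + \<i> * of_real y))"
proof -
  have "continuous_on (strip \<theta>) \<psi>" using assms holomorphic_on_imp_continuous_on by blast
  then show ?thesis
    by (rule continuous_on_compose2) (use assms in \<open>auto simp: strip_pos intro!: continuous_intros\<close>)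
qed

lemma integrable_on_line:
  assumes "\<theta> > 0" "\<psi> holomorphic_on strip \<theta>" "\<bar>y\<bar> < \<theta>"
    and "\<And>z. z \<in> strip \<theta> \<Longrightarrow> cmod (\<psi> z) \<le> C / (1 + (Re z)\<^sup>2)"
  shows "integrable lborel (\<lambda>x. \<psi> (of_real x + \<i> * of_real y))"
proof (rule Bochner_Integration.integrable_bound)
  show "integrable lborel (\<lambda>x. C * (1 / (1 + x\<^sup>2)))"
    using integrable_inverse_1_plus_sq by (rule integrable_mult_right)
  show "(\<lambda>x. \<psi> (of_real x + \<i> * of_real y)) \<in> borel_measurable lborel"
    using continuous_on_line[OF assms(1-3)] by (simp add: borel_measurable_continuous_onI)
  show "AE x in lborel. cmod (\<psi> (of_real x + \<i> * of_real y)) \<le> norm (C * (1 / (1 + x\<^sup>2)))"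
  proof (rule AE_I2)
    fix x :: real
    have "cmod (\<psi> (of_real x + \<i> * of_real y)) \<le> C / (1 + x\<^sup>2)"
      using assms(4)[of "of_real x + \<i> * of_real y"] assms(1,3) by (simp add: strip_pos)
    also have "\<dots> \<le> norm (C * (1 / (1 + x\<^sup>2)))"
      by (simp add: divide_right_mono)
    finally show "cmod (\<psi> (of_real x + \<i> * of_real y)) \<le> norm (C * (1 / (1 + x\<^sup>2)))" .
  qed
qed

text \<open>The line has distance |y - Im z| > 0 from z, so the kernel 1 / (w - z) is bounded on it
  and integrability is inherited from \<open>\<psi>\<close>.\<close>

lemma integrable_Cauchy_kernel_line:
  assumes "\<theta> > 0" "\<psi> holomorphic_on strip \<theta>" "\<bar>y\<bar> < \<theta>"
    and "\<And>z. z \<in> strip \<theta> \<Longrightarrow> cmod (\<psi> z) \<le> C / (1 + (Re z)\<^sup>2)"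
    and "y \<noteq> Im z"
  shows "integrable lborel (\<lambda>x. \<psi> (of_real x + \<i> * of_real y) / (of_real x + \<i> * of_real y - z))"
proof (rule Bochner_Integration.integrable_bound)
  note int = integrable_on_line[OF assms(1-4)]
  have ne: "of_real x + \<i> * of_real y - z \<noteq> 0" for x
    using assms(5) by (auto simp: complex_eq_iff)
  show "integrable lborel (\<lambda>x. (1 / \<bar>y - Im z\<bar>) * cmod (\<psi> (of_real x + \<i> * of_real y)))"
    using int by auto
  show "(\<lambda>x. \<psi> (of_real x + \<i> * of_real y) / (of_real x + \<i> * of_real y - z)) \<in> borel_measurable lborel"
    using int by measurable
  show "AE x in lborel. cmod (\<psi> (of_real x + \<i> * of_real y) / (of_real x + \<i> * of_real y - z))
        \<le> norm ((1 / \<bar>y - Im z\<bar>) * cmod (\<psi> (of_real x + \<i> * of_real y)))"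
  proof (rule AE_I2)
    fix x :: real
    have "\<bar>y - Im z\<bar> \<le> cmod (of_real x + \<i> * of_real y - z)"
      using abs_Im_le_cmod[of "of_real x + \<i> * of_real y - z"] by simp
    then have "cmod (\<psi> (of_real x + \<i> * of_real y)) / cmod (of_real x + \<i> * of_real y - z)
          \<le> cmod (\<psi> (of_real x + \<i> * of_real y)) / \<bar>y - Im z\<bar>"
      using assms(5) by (intro divide_left_mono) (auto intro!: mult_pos_pos simp: ne)
    then show "cmod (\<psi> (of_real x + \<i> * of_real y) / (of_real x + \<i> * of_real y - z))
        \<le> norm ((1 / \<bar>y - Im z\<bar>) * cmod (\<psi> (of_real x + \<i> * of_real y)))"
      by (simp add: norm_divide)
  qed
qed

text \<open>Cauchy's formula on the rectangle [-n, n] x [-\<eta>, \<eta>], with n tending to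
  infinity. The vertical sides disappear because of the decay of \<open>\<psi>\<close>; the top side
  is traversed from right to left, whence the minus sign.\<close>

lemma Cauchy_integral_formula_strip:
  assumes \<theta>: "0 < \<eta>" "\<eta> < \<theta>" and hol: "\<psi> holomorphic_on strip \<theta>"
    and bd: "\<And>z. z \<in> strip \<theta> \<Longrightarrow> cmod (\<psi> z) \<le> C / (1 + (Re z)\<^sup>2)"
    and z: "\<bar>Im z\<bar> < \<eta>"
  shows "2 * of_real pi * \<i> * \<psi> z =
     (\<integral>x. \<psi> (of_real x + \<i> * of_real (-\<eta>)) / (of_real x + \<i> * of_real (-\<eta>) - z) \<partial>lborel)
     - (\<integral>x. \<psi> (of_real x + \<i> * of_real \<eta>) / (of_real x + \<i> * of_real \<eta> - z) \<partial>lborel)"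
proof -
  define F where "F w = \<psi> w / (w - z)" for w
  have \<theta>0: "\<theta> > 0" using \<theta> by simp
  have C0: "C \<ge> 0" using bd[of 0] \<theta>0 by (simp add: strip_pos) (meson norm_ge_zero order_trans)
  define p where "p x = complex_of_real x + \<i> * of_real (-\<eta>)" for x
  define q where "q x = complex_of_real x + \<i> * of_real \<eta>" for x
  \<comment> \<open>The contribution of the two vertical sides.\<close>
  define V where "V n = contour_integral (linepath (p (real n)) (q (real n))) F
      + contour_integral (linepath (q (- real n)) (p (- real n))) F" for n :: nat
  have seg: "w \<noteq> z \<and> w \<in> strip \<theta> \<and> \<bar>Re w\<bar> = n"
    if "w \<in> closed_segment (p r) (q r) \<or> w \<in> closed_segment (q r) (p r)" "\<bar>r\<bar> = n" "n > \<bar>Re z\<bar>" for w n r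
    using that \<theta> by (auto simp: closed_segment_same_Re p_def q_def strip_pos closed_segment_eq_real_ivl split: if_splits)
  have segh: "w \<noteq> z \<and> w \<in> strip \<theta>"
    if "w \<in> closed_segment (p r) (p r') \<or> w \<in> closed_segment (q r) (q r')" for w r r'
    using that \<theta> z by (auto simp: closed_segment_same_Im p_def q_def strip_pos closed_segment_eq_real_ivl split: if_splits)
  have vseg: "closed_segment (p r) (q r) \<subseteq> strip \<theta> - {z}" "closed_segment (q r) (p r) \<subseteq> strip \<theta> - {z}"
    if "\<bar>Re z\<bar> < \<bar>r\<bar>" for r
    using seg[where r = r and n = "\<bar>r\<bar>"] that by blast+
  have hseg: "closed_segment (p r) (p r') \<subseteq> strip \<theta> - {z}" "closed_segment (q r) (q r') \<subseteq> strip \<theta> - {z}" for r r'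
    using segh by blast+
  have contF: "continuous_on S F" if "S \<subseteq> strip \<theta> - {z}" for S
    unfolding F_def using that hol
    by (intro continuous_intros holomorphic_on_imp_continuous_on[OF holomorphic_on_subset]) auto
  have main: "2 * of_real pi * \<i> * \<psi> z =
      integral {-real n..real n} (\<lambda>x. F (p x)) - integral {-real n..real n} (\<lambda>x. F (q x)) + V n"
    if n: "real n > \<bar>Re z\<bar>" for n
  proof -
    let ?n = "real n"
    have pq: "Complex (Re (q ?n)) (Im (p (-?n))) = p ?n" "Complex (Re (p (-?n))) (Im (q ?n)) = q (-?n)"
      by (simp_all add: p_def q_def complex_eq_iff)
    have rect: "rectpath (p (-?n)) (q ?n) = linepath (p (-?n)) (p ?n) +++ linepath (p ?n) (q ?n)
        +++ linepath (q ?n) (q (-?n)) +++ linepath (q (-?n)) (p (-?n))"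
      unfolding rectpath_def Let_def pq ..
    have box: "z \<in> box (p (-?n)) (q ?n)"
      using n z by (auto simp: in_box_complex_iff p_def q_def)
    have sub: "path_image (rectpath (p (-?n)) (q ?n)) \<subseteq> strip \<theta> - {z}"
      using n \<theta> z by (subst path_image_rectpath) (auto simp: p_def q_def strip_pos)
    have "(F has_contour_integral (2*pi * \<i> * winding_number (rectpath (p (-?n)) (q ?n)) z * \<psi> z))
        (rectpath (p (-?n)) (q ?n))"
      unfolding F_def
      by (rule Cauchy_integral_formula_convex_simple[OF convex_strip[OF \<theta>0] hol])
         (use sub open_strip[OF \<theta>0] z \<theta> in \<open>auto simp: interior_open strip_pos\<close>)
    then have A: "contour_integral (rectpath (p (-?n)) (q ?n)) F = 2 * of_real pi * \<i> * \<psi> z"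
      using winding_number_rectpath[OF box] by (simp add: contour_integral_unique)
    have ci: "F contour_integrable_on linepath (p (-?n)) (p ?n)"
      "F contour_integrable_on linepath (p ?n) (q ?n)"
      "F contour_integrable_on linepath (q ?n) (q (-?n))"
      "F contour_integrable_on linepath (q (-?n)) (p (-?n))"
      "F contour_integrable_on linepath (q (-?n)) (q ?n)"
      by (intro contour_integrable_continuous_linepath contF vseg hseg; use n in simp)+
    have B: "contour_integral (rectpath (p (-?n)) (q ?n)) F =
       contour_integral (linepath (p (-?n)) (p ?n)) F + contour_integral (linepath (p ?n) (q ?n)) F
       + contour_integral (linepath (q ?n) (q (-?n))) F + contour_integral (linepath (q (-?n)) (p (-?n))) F"
      unfolding rect using ci by (simp add: contour_integrable_join)
    have rev: "contour_integral (linepath (q ?n) (q (-?n))) F = - contour_integral (linepath (q (-?n)) (q ?n)) F"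
      by (rule contour_integral_reverse_linepath[OF contF[OF hseg(2)]])
    have "((\<lambda>x. F (p x)) has_integral contour_integral (linepath (p (-?n)) (p ?n)) F) {-?n..?n}"
      using has_contour_integral_integral[OF ci(1)]
      unfolding p_def by (subst has_contour_integral_horizontal_iff[symmetric]) (use n in auto)
    moreover have "((\<lambda>x. F (q x)) has_integral contour_integral (linepath (q (-?n)) (q ?n)) F) {-?n..?n}"
      using has_contour_integral_integral[OF ci(5)]
      unfolding q_def by (subst has_contour_integral_horizontal_iff[symmetric]) (use n in auto)
    ultimately show ?thesis
      unfolding A[symmetric] B rev V_def by (simp add: integral_unique)
  qed
  \<comment> \<open>The margin 1 beyond |Re z| gives |w - z| \<ge> 1 on the vertical sides, so
    \<open>F\<close> obeys the bound of \<open>\<psi>\<close> there; each side has length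
    2\<eta>.\<close>
  have Vbd: "cmod (V n) \<le> 4 * \<eta> * C / (1 + (real n)\<^sup>2)" if n: "real n > \<bar>Re z\<bar> + 1" for n
  proof -
    let ?n = "real n"
    have ci: "F contour_integrable_on linepath (p ?n) (q ?n)"
      "F contour_integrable_on linepath (q (-?n)) (p (-?n))"
      by (intro contour_integrable_continuous_linepath contF vseg; use n in simp)+
    have Fb: "cmod (F w) \<le> C / (1 + ?n\<^sup>2)"
      if w: "w \<in> closed_segment (p r) (q r) \<or> w \<in> closed_segment (q r) (p r)" "\<bar>r\<bar> = ?n" for w r
    proof -
      have w': "w \<noteq> z" "w \<in> strip \<theta>" "\<bar>Re w\<bar> = ?n" using seg[OF w] n by auto
      have "(Re w)\<^sup>2 = ?n\<^sup>2" using w'(3) by (metis power2_abs)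
      then have 1: "cmod (\<psi> w) \<le> C / (1 + ?n\<^sup>2)" using bd[OF w'(2)] by simp
      have 2: "1 \<le> cmod (w - z)" using abs_Re_le_cmod[of "w - z"] w'(3) n by simp
      have "cmod (F w) = cmod (\<psi> w) / cmod (w - z)" by (simp add: F_def norm_divide)
      also have "\<dots> \<le> cmod (\<psi> w) / 1" using 2 by (intro divide_left_mono) auto
      finally show ?thesis using 1 by simp
    qed
    have len: "cmod (q r - p r) = 2 * \<eta>" "cmod (p r - q r) = 2 * \<eta>" for r
      using \<theta> by (simp_all add: p_def q_def cmod_def real_sqrt_mult)
    have pos: "0 \<le> C / (1 + ?n\<^sup>2)" using C0 by simp
    have "cmod (contour_integral (linepath (p ?n) (q ?n)) F) \<le> C / (1 + ?n\<^sup>2) * (2 * \<eta>)"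
      using contour_integral_bound_linepath[OF ci(1) pos Fb[where r = ?n]] by (auto simp: len)
    moreover have "cmod (contour_integral (linepath (q (-?n)) (p (-?n))) F) \<le> C / (1 + ?n\<^sup>2) * (2 * \<eta>)"
      using contour_integral_bound_linepath[OF ci(2) pos Fb[where r = "-?n"]] by (auto simp: len)
    ultimately have "cmod (V n) \<le> C / (1 + ?n\<^sup>2) * (2 * \<eta>) + C / (1 + ?n\<^sup>2) * (2 * \<eta>)"
      unfolding V_def by (rule norm_triangle_mono)
    then show ?thesis by (simp add: field_simps)
  qed
  have ev: "\<forall>\<^sub>F n in sequentially. real n > \<bar>Re z\<bar> + 1"
    using filterlim_real_sequentially by (auto simp: filterlim_at_top_dense)
  have V0: "V \<longlonglongrightarrow> 0"
  proof (rule Lim_null_comparison)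
    show "\<forall>\<^sub>F n in sequentially. cmod (V n) \<le> 4 * \<eta> * C / (1 + (real n)\<^sup>2)"
      using ev by eventually_elim (rule Vbd)
    show "(\<lambda>n. 4 * \<eta> * C / (1 + (real n)\<^sup>2)) \<longlonglongrightarrow> 0" by real_asymp
  qed
  have "(\<lambda>n. integral {-real n..real n} (\<lambda>x. F (p x)) - integral {-real n..real n} (\<lambda>x. F (q x)) + V n)
     \<longlonglongrightarrow> integral\<^sup>L lborel (\<lambda>x. F (p x)) - integral\<^sup>L lborel (\<lambda>x. F (q x)) + 0"
    unfolding F_def p_def q_def
    using z \<theta> V0[unfolded F_def p_def q_def]
    by (intro tendsto_intros integral_symmetric_interval_tendsto
          integrable_Cauchy_kernel_line[OF \<theta>0 hol _ bd]) auto
  moreover have "\<forall>\<^sub>F n in sequentially. integral {-real n..real n} (\<lambda>x. F (p x))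
      - integral {-real n..real n} (\<lambda>x. F (q x)) + V n = 2 * of_real pi * \<i> * \<psi> z"
    using ev by eventually_elim (rule main[symmetric], linarith)
  then have "(\<lambda>n. integral {-real n..real n} (\<lambda>x. F (p x))
      - integral {-real n..real n} (\<lambda>x. F (q x)) + V n) \<longlonglongrightarrow> 2 * of_real pi * \<i> * \<psi> z"
    by (rule tendsto_eventually)
  ultimately have "integral\<^sup>L lborel (\<lambda>x. F (p x)) - integral\<^sup>L lborel (\<lambda>x. F (q x)) + 0
      = 2 * of_real pi * \<i> * \<psi> z"
    by (rule LIMSEQ_unique)
  then show ?thesis by (simp add: F_def p_def q_def)
qed

subsection \<open>Fourier representation of holomorphic functions on a strip\<close>

lemma integrable_exp_minus_half_line:
  assumes a: "a > (0::real)"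
  shows "integrable lborel (\<lambda>s. indicator {0<..} s * exp (- (a * s)))"
proof -
  have "set_integrable lebesgue {0..} (\<lambda>x. exp (- a * x))"
    by (intro nonnegative_absolutely_integrable_1 integrable_on_exp_minus_to_infinity a) auto
  then have "set_integrable lborel {0..} (\<lambda>x. exp (- a * x))"
    unfolding set_integrable_def
    by (subst integrable_completion[symmetric]) auto
  then have "set_integrable lborel {0<..} (\<lambda>x. exp (- a * x))"
    by (rule set_integrable_subset) auto
  then show ?thesis by (simp add: set_integrable_def)
qed

text \<open>The open half-line and its reflection miss only the null set {0}, so the integrability
  on the half-line can be used twice.\<close>

lemma integrable_exp_minus_abs:
  assumes a: "a > (0::real)"
  shows "integrable lborel (\<lambda>s. exp (- (a * \<bar>s\<bar>)))"
proof -
  let ?h = "\<lambda>s. indicator {0<..} s * exp (- (a * s))"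
  have "integrable lborel (\<lambda>s. ?h s + ?h (0 + (-1) * s))"
    using integrable_exp_minus_half_line[OF a]
    by (intro Bochner_Integration.integrable_add lborel_integrable_real_affine) auto
  moreover have "AE s in lborel. ?h s + ?h (0 + (-1) * s) = exp (- (a * \<bar>s\<bar>))"
    using AE_lborel_singleton[of 0] by eventually_elim (auto simp: indicator_def)
  ultimately show ?thesis
    by (subst integrable_cong_AE[symmetric, where f = "\<lambda>s. ?h s + ?h (0 + (-1) * s)"]) auto
qed

text \<open>The primitive exp(isc) / (ic) vanishes at infinity because |exp(isc)| = exp(-s Im c).
  With c = w - z the formula writes the Cauchy kernel as a superposition of exponentials in
  z.\<close>

lemma integral_exp_half_line:
  assumes c: "Im c > 0"
  shows "(\<integral>s. indicator {0<..} s *\<^sub>R exp (\<i> * of_real s * c) \<partial>lborel) = \<i> / c"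
    (is "integral\<^sup>L _ ?f = _")
proof -
  have c0: "c \<noteq> 0" using c by auto
  have nrm: "cmod (exp (\<i> * of_real s * c)) = exp (- (Im c * s))" for s
    by (simp add: norm_exp_eq_Re mult.commute)
  have int: "integrable lborel ?f"
  proof (rule Bochner_Integration.integrable_bound[OF integrable_exp_minus_half_line[OF c]])
    show "?f \<in> borel_measurable lborel" by measurable
  qed (auto simp: nrm indicator_def)
  have "(LBINT s=0..\<infinity>. exp (\<i> * of_real s * c)) = 0 - 1 / (\<i> * c)"
  proof (rule interval_integral_FTC_integrable[where F = "\<lambda>s. exp (\<i> * of_real s * c) / (\<i> * c)"])
    show "((\<lambda>s. exp (\<i> * of_real s * c) / (\<i> * c)) has_vector_derivative exp (\<i> * of_real x * c)) (at x)" for x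
    proof -
      have "((\<lambda>z. exp (\<i> * z * c) / (\<i> * c)) has_field_derivative exp (\<i> * of_real x * c)) (at (of_real x))"
        using c0 by (auto intro!: derivative_eq_intros)
      from has_vector_derivative_real_field[OF this] show ?thesis .
    qed
    show "set_integrable lborel (einterval 0 \<infinity>) (\<lambda>s. exp (\<i> * of_real s * c))"
      using int by (simp add: set_integrable_def einterval_def greaterThan_def)
    show "(((\<lambda>s. exp (\<i> * of_real s * c) / (\<i> * c)) \<circ> real_of_ereal) \<longlongrightarrow> 1 / (\<i> * c)) (at_right 0)"
      using c0 by (auto simp: zero_ereal_def ereal_tendsto_simps intro!: tendsto_eq_intros)
    have "((\<lambda>s. exp (- (Im c * s))) \<longlongrightarrow> 0) at_top"
      using c by real_asymp
    then have "((\<lambda>s. exp (\<i> * of_real s * c)) \<longlongrightarrow> 0) at_top"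
      by (subst tendsto_norm_zero_iff[symmetric]) (simp only: nrm)
    then have "((\<lambda>s. exp (\<i> * of_real s * c) / (\<i> * c)) \<longlongrightarrow> 0 / (\<i> * c)) at_top"
      by (intro tendsto_divide) (use c0 in auto)
    then show "(((\<lambda>s. exp (\<i> * of_real s * c) / (\<i> * c)) \<circ> real_of_ereal) \<longlongrightarrow> 0) (at_left \<infinity>)"
      by (simp add: ereal_tendsto_simps)
  qed auto
  moreover have "(LBINT s=0..\<infinity>. exp (\<i> * of_real s * c)) = integral\<^sup>L lborel ?f"
    by (simp add: interval_lebesgue_integral_def set_lebesgue_integral_def einterval_def greaterThan_def)
  moreover have "0 - 1 / (\<i> * c) = \<i> / c" using c0 by (simp add: divide_simps)
  ultimately show ?thesis by simp
qed

text \<open>If \<open>h x\<close> is the value of a function at w = x + i\<eta>, this is its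
  integral against exp(isw) along the line Im w = \<eta>, kept only for s > 0. There |exp(isw)| =
  exp(-\<eta>s), which decays when \<eta> > 0.\<close>

definition half_transform :: "(real \<Rightarrow> complex) \<Rightarrow> real \<Rightarrow> real \<Rightarrow> complex" where
  "half_transform h \<eta> s =
     indicator {0<..} s *\<^sub>R (\<integral>x. h x * exp (\<i> * of_real s * (of_real x + \<i> * of_real \<eta>)) \<partial>lborel)"

lemma measurable_half_transform [measurable]:
  assumes [measurable]: "h \<in> borel_measurable borel"
  shows "half_transform h \<eta> \<in> borel_measurable borel"
  unfolding half_transform_def by measurable

lemma norm_half_transform_le:
  assumes h: "integrable lborel h"
  shows "cmod (half_transform h \<eta> s) \<le> indicator {0<..} s * (exp (- (\<eta> * s)) * (\<integral>x. cmod (h x) \<partial>lborel))"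
proof -
  have "cmod (\<integral>x. h x * exp (\<i> * of_real s * (of_real x + \<i> * of_real \<eta>)) \<partial>lborel)
      \<le> (\<integral>x. cmod (h x * exp (\<i> * of_real s * (of_real x + \<i> * of_real \<eta>))) \<partial>lborel)"
    by (rule integral_norm_bound)
  also have "\<dots> = (\<integral>x. exp (- (\<eta> * s)) * cmod (h x) \<partial>lborel)"
    by (simp add: norm_mult norm_exp_eq_Re mult.commute)
  also have "\<dots> = exp (- (\<eta> * s)) * (\<integral>x. cmod (h x) \<partial>lborel)"
    by simp
  finally show ?thesis by (simp add: half_transform_def indicator_def)
qed

text \<open>Fubini: the joint integrand has modulus |h(x)| exp(-(\<eta> - Im z) s) on s > 0, which
  is integrable on the product. The inner integral over s is \<open>integral_exp_half_line\<close>
  at c = x + i\<eta> - z.\<close>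

lemma fourier_half_transform:
  assumes h: "integrable lborel h" and z: "Im z < \<eta>"
  shows "integrable lborel (\<lambda>s. half_transform h \<eta> s * exp (- \<i> * of_real s * z))"
    and "fourier (half_transform h \<eta>) z = (\<integral>x. h x * (\<i> / (of_real x + \<i> * of_real \<eta> - z)) \<partial>lborel)"
proof -
  have [measurable]: "h \<in> borel_measurable borel" using h by auto
  define F where "F x s = indicator {0<..} s *\<^sub>R (h x * exp (\<i> * of_real s * (of_real x + \<i> * of_real \<eta> - z)))"
    for x s :: real
  have nF: "cmod (F x s) = cmod (h x) * (indicator {0<..} s * exp (- ((\<eta> - Im z) * s)))" for x s
    by (simp add: F_def norm_mult norm_exp_eq_Re algebra_simps)
  note ei = integrable_exp_minus_half_line[of "\<eta> - Im z"]
  have iF: "integrable (lborel \<Otimes>\<^sub>M lborel) (case_prod F)"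
  proof (rule lborel_pair.Fubini_integrable)
    show "case_prod F \<in> borel_measurable (lborel \<Otimes>\<^sub>M lborel)"
      unfolding F_def by measurable
    show "integrable lborel (\<lambda>x. \<integral>s. norm (case (x, s) of (x, s) \<Rightarrow> F x s) \<partial>lborel)"
      using h by (simp add: nF)
    show "AE x in lborel. integrable lborel (\<lambda>s. case (x, s) of (x, s) \<Rightarrow> F x s)"
    proof (rule AE_I2)
      fix x
      have "integrable lborel (\<lambda>s. cmod (h x) * (indicator {0<..} s * exp (- ((\<eta> - Im z) * s))))"
        using ei z by simp
      then show "integrable lborel (\<lambda>s. case (x, s) of (x, s) \<Rightarrow> F x s)"
        by (rule Bochner_Integration.integrable_bound) (simp_all add: nF, simp add: F_def)
    qed
  qed
  have eq: "(\<integral>x. F x s \<partial>lborel) = half_transform h \<eta> s * exp (- \<i> * of_real s * z)" for s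
  proof -
    have e: "exp (\<i> * of_real s * (w - z)) = exp (- \<i> * of_real s * z) * exp (\<i> * of_real s * w)" for w
      by (simp add: mult_exp_exp algebra_simps)
    have "F x s = (indicator {0<..} s *\<^sub>R exp (- \<i> * of_real s * z)) *
        (h x * exp (\<i> * of_real s * (of_real x + \<i> * of_real \<eta>)))" for x
      by (simp add: F_def e)
    then show ?thesis by (simp add: half_transform_def)
  qed
  show "integrable lborel (\<lambda>s. half_transform h \<eta> s * exp (- \<i> * of_real s * z))"
    using lborel_pair.integrable_snd[OF iF] by (simp only: eq)
  have "fourier (half_transform h \<eta>) z = (\<integral>s. (\<integral>x. F x s \<partial>lborel) \<partial>lborel)"
    by (simp only: eq fourier_def)
  also have "\<dots> = (\<integral>x. (\<integral>s. F x s \<partial>lborel) \<partial>lborel)"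
    by (rule lborel_pair.Fubini_integral[OF iF])
  also have "(\<lambda>x. \<integral>s. F x s \<partial>lborel) = (\<lambda>x. h x * (\<i> / (of_real x + \<i> * of_real \<eta> - z)))"
  proof
    fix x
    have "(\<integral>s. F x s \<partial>lborel) = (\<integral>s. h x *
        (indicator {0<..} s *\<^sub>R exp (\<i> * of_real s * (of_real x + \<i> * of_real \<eta> - z))) \<partial>lborel)"
      by (simp add: F_def)
    also have "\<dots> = h x * (\<i> / (of_real x + \<i> * of_real \<eta> - z))"
      by (subst integral_mult_right_zero, subst integral_exp_half_line) (use z in auto)
    finally show "(\<integral>s. F x s \<partial>lborel) = h x * (\<i> / (of_real x + \<i> * of_real \<eta> - z))" .
  qed
  finally show "fourier (half_transform h \<eta>) z = (\<integral>x. h x * (\<i> / (of_real x + \<i> * of_real \<eta> - z)) \<partial>lborel)" .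
qed

text \<open>The inverse Fourier transform of \<open>\<psi>\<close> with the line of integration moved to \<open>Im z = \<eta>\<close> for
  \<open>s > 0\<close> and to \<open>Im z = -\<eta>\<close> for \<open>s < 0\<close>, which makes the decay \<open>exp (-\<eta>\<bar>s\<bar>)\<close> visible.\<close>

definition strip_symbol :: "(complex \<Rightarrow> complex) \<Rightarrow> real \<Rightarrow> real \<Rightarrow> complex" where
  "strip_symbol \<psi> \<eta> s = (half_transform (\<lambda>x. \<psi> (of_real x + \<i> * of_real \<eta>)) \<eta> s
     + half_transform (\<lambda>x. \<psi> (of_real (- x) + \<i> * of_real (-\<eta>))) \<eta> (- s)) / (2 * of_real pi)"

definition line_norm :: "(complex \<Rightarrow> complex) \<Rightarrow> real \<Rightarrow> real" where
  "line_norm \<psi> y = (\<integral>x. cmod (\<psi> (of_real x + \<i> * of_real y)) \<partial>lborel)"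

lemma line_norm_nonneg: "line_norm \<psi> y \<ge> 0"
  by (simp add: line_norm_def)

section \<open>The two-sided symbol of a holomorphic function and its Fourier transform\<close>

context
  fixes \<eta> \<theta> C :: real and \<psi> :: "complex \<Rightarrow> complex"
  assumes \<theta>: "0 < \<eta>" "\<eta> < \<theta>" and hol: "\<psi> holomorphic_on strip \<theta>"
    and bd: "\<And>z. z \<in> strip \<theta> \<Longrightarrow> cmod (\<psi> z) \<le> C / (1 + (Re z)\<^sup>2)"
begin

private lemma line_upper: "integrable lborel (\<lambda>x. \<psi> (of_real x + \<i> * of_real \<eta>))"
  by (rule integrable_on_line[OF _ hol _ bd]) (use \<theta> in auto)

private lemma line_lower0: "integrable lborel (\<lambda>x. \<psi> (of_real x + \<i> * of_real (-\<eta>)))"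
  by (rule integrable_on_line[OF _ hol _ bd]) (use \<theta> in auto)

text \<open>The reflection w -> -w carries the line Im w = \<eta> to Im w = -\<eta>, so that
  negative s can be treated by the same half-line transform as positive s.\<close>

private lemma line_lower: "integrable lborel (\<lambda>x. \<psi> (of_real (-x) + \<i> * of_real (-\<eta>)))"
  using lborel_integrable_real_affine[OF line_lower0, of "-1" 0] by simp

lemma measurable_strip_symbol: "strip_symbol \<psi> \<eta> \<in> borel_measurable borel"
proof -
  have [measurable]: "(\<lambda>x. \<psi> (of_real x + \<i> * of_real \<eta>)) \<in> borel_measurable borel"
    "(\<lambda>x. \<psi> (of_real (-x) + \<i> * of_real (-\<eta>))) \<in> borel_measurable borel"
    using borel_measurable_integrable[OF line_upper] borel_measurable_integrable[OF line_lower] by auto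
  show ?thesis unfolding strip_symbol_def by measurable
qed

text \<open>Each half is supported on its own half-line and decays there, the constant being the
  integral of the modulus of \<open>\<psi>\<close> along its line; the factor 1 / (2 pi) is
  estimated by 1.\<close>

lemma norm_strip_symbol_le:
  "cmod (strip_symbol \<psi> \<eta> s) \<le> (line_norm \<psi> \<eta> + line_norm \<psi> (-\<eta>)) * exp (- (\<eta> * \<bar>s\<bar>))"
proof -
  let ?a = "half_transform (\<lambda>x. \<psi> (of_real x + \<i> * of_real \<eta>)) \<eta> s"
  let ?b = "half_transform (\<lambda>x. \<psi> (of_real (- x) + \<i> * of_real (-\<eta>))) \<eta> (- s)"
  have ln: "(\<integral>x. cmod (\<psi> (of_real (-x) + \<i> * of_real (-\<eta>))) \<partial>lborel) = line_norm \<psi> (-\<eta>)"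
    using lborel_integral_real_affine[of "-1" "\<lambda>x. cmod (\<psi> (of_real x + \<i> * of_real (-\<eta>)))" 0]
    by (simp add: line_norm_def)
  have ind: "indicator {0<..} t * (exp (- (\<eta> * t)) * m) \<le> m * exp (- (\<eta> * \<bar>t\<bar>))" if "m \<ge> 0" for t m :: real
    using that by (auto simp: indicator_def mult.commute)
  have "cmod ?a \<le> line_norm \<psi> \<eta> * exp (- (\<eta> * \<bar>s\<bar>))"
    using order_trans[OF norm_half_transform_le[OF line_upper, of \<eta> s] ind]
    by (simp add: line_norm_def)
  moreover have "cmod ?b \<le> line_norm \<psi> (-\<eta>) * exp (- (\<eta> * \<bar>s\<bar>))"
    using order_trans[OF norm_half_transform_le[OF line_lower, of \<eta> "-s"] ind]
    unfolding ln by (simp add: line_norm_nonneg)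
  ultimately have *: "cmod (?a + ?b) \<le> (line_norm \<psi> \<eta> + line_norm \<psi> (-\<eta>)) * exp (- (\<eta> * \<bar>s\<bar>))"
    unfolding distrib_right by (rule norm_triangle_mono)
  have "cmod (strip_symbol \<psi> \<eta> s) = cmod (?a + ?b) / (2 * pi)"
    by (simp add: strip_symbol_def norm_divide norm_mult)
  also have "\<dots> \<le> cmod (?a + ?b) / 1"
    using pi_gt3 by (intro divide_left_mono) auto
  finally show ?thesis using * by simp
qed

text \<open>The upper half yields i times the Cauchy integral over Im w = \<eta>, the lower half -i
  times the one over Im w = -\<eta>. Together they are -i times Cauchy's formula on the strip, that
  is 2 pi times the value of \<open>\<psi>\<close> at z.\<close>

lemma fourier_strip_symbol:
  assumes z: "\<bar>Im z\<bar> < \<eta>"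
  shows "fourier (strip_symbol \<psi> \<eta>) z = \<psi> z"
proof -
  let ?h = "\<lambda>x. \<psi> (of_real x + \<i> * of_real \<eta>)" and ?k = "\<lambda>x. \<psi> (of_real (- x) + \<i> * of_real (-\<eta>))"
  have alg: "\<i> * P + (-\<i>) * Q = (-\<i>) * (Q - P)" for P Q
    by (simp add: algebra_simps)
  \<comment> \<open>The lower half is transformed at -z because its variable s is reflected; hence
    both bounds on Im z are used.\<close>
  have z1: "Im z < \<eta>" and z2: "Im (- z) < \<eta>" using z by auto
  note A = fourier_half_transform[OF line_upper z1]
  note B = fourier_half_transform[OF line_lower z2]
  have B1: "integrable lborel (\<lambda>s. half_transform ?k \<eta> (-s) * exp (- \<i> * of_real s * z))"
    using lborel_integrable_real_affine[OF B(1), of "-1" 0] by simp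
  have B2: "(\<integral>s. half_transform ?k \<eta> (-s) * exp (- \<i> * of_real s * z) \<partial>lborel) = fourier (half_transform ?k \<eta>) (-z)"
    unfolding fourier_def
    by (subst (2) lborel_integral_real_affine[of "-1" _ 0]) auto
  have "fourier (strip_symbol \<psi> \<eta>) z =
     (\<integral>s. (half_transform ?h \<eta> s * exp (- \<i> * of_real s * z)
        + half_transform ?k \<eta> (-s) * exp (- \<i> * of_real s * z)) / (2 * of_real pi) \<partial>lborel)"
    unfolding fourier_def strip_symbol_def by (simp add: distrib_right)
  also have "\<dots> = (fourier (half_transform ?h \<eta>) z + fourier (half_transform ?k \<eta>) (-z)) / (2 * of_real pi)"
    unfolding B2[symmetric] using A(1) B1 by (simp add: fourier_def)
  also have "fourier (half_transform ?k \<eta>) (-z) =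
      (\<integral>x. \<psi> (of_real x + \<i> * of_real (-\<eta>)) * (\<i> / (- of_real x + \<i> * of_real \<eta> + z)) \<partial>lborel)"
    unfolding B(2) by (subst lborel_integral_real_affine[of "-1" _ 0]) auto
  also have "\<dots> = (\<integral>x. (-\<i>) * (\<psi> (of_real x + \<i> * of_real (-\<eta>)) / (of_real x + \<i> * of_real (-\<eta>) - z)) \<partial>lborel)"
  proof (rule Bochner_Integration.integral_cong)
    fix x :: real
    have "- of_real x + \<i> * of_real \<eta> + z = - (of_real x + \<i> * of_real (-\<eta>) - z)" by simp
    moreover have "c * (\<i> / (- d)) = (-\<i>) * (c / d)" for c d by simp
    ultimately show "\<psi> (of_real x + \<i> * of_real (-\<eta>)) * (\<i> / (- of_real x + \<i> * of_real \<eta> + z))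
      = (-\<i>) * (\<psi> (of_real x + \<i> * of_real (-\<eta>)) / (of_real x + \<i> * of_real (-\<eta>) - z))"
      by (simp only:)
  qed simp
  also have "\<dots> = (-\<i>) * (\<integral>x. \<psi> (of_real x + \<i> * of_real (-\<eta>)) / (of_real x + \<i> * of_real (-\<eta>) - z) \<partial>lborel)"
    by (rule integral_mult_right_zero)
  also have "fourier (half_transform ?h \<eta>) z =
      (\<integral>x. \<i> * (\<psi> (of_real x + \<i> * of_real \<eta>) / (of_real x + \<i> * of_real \<eta> - z)) \<partial>lborel)"
    unfolding A(2) by (simp add: mult.commute)
  also have "\<dots> = \<i> * (\<integral>x. \<psi> (of_real x + \<i> * of_real \<eta>) / (of_real x + \<i> * of_real \<eta> - z) \<partial>lborel)"
    by (rule integral_mult_right_zero)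
  also have "(\<i> * (\<integral>x. \<psi> (of_real x + \<i> * of_real \<eta>) / (of_real x + \<i> * of_real \<eta> - z) \<partial>lborel)
      + (-\<i>) * (\<integral>x. \<psi> (of_real x + \<i> * of_real (-\<eta>)) / (of_real x + \<i> * of_real (-\<eta>) - z) \<partial>lborel))
      = (-\<i>) * (2 * of_real pi * \<i> * \<psi> z)"
    by (simp only: alg Cauchy_integral_formula_strip[OF \<theta> hol bd z])
  finally show ?thesis by simp
qed

end

subsection \<open>The algebra W\<close>

text \<open>Decay with rate \<eta> > \<omega> beats the weight, since v grows subexponentially.
  \<open>K\<close> is chosen before \<open>g\<close> and \<open>M\<close>, so one constant serves
  all functions.\<close>

lemma exp_decay_weighted_norm:
  assumes v: "admissible v" and \<omega>: "\<omega> < \<eta>"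
  shows "\<exists>K. \<forall>g M. g \<in> borel_measurable borel \<longrightarrow> (\<forall>s. cmod (g s) \<le> M * exp (- (\<eta> * \<bar>s\<bar>))) \<longrightarrow>
     integrable lborel (\<lambda>s. (cmod (wt v \<omega> g s))\<^sup>2) \<and>
     sqrt (\<integral>s. (cmod (wt v \<omega> g s))\<^sup>2 \<partial>lborel) \<le> K * M"
proof -
  \<comment> \<open>Half of the gap \<eta> - \<omega> absorbs the growth of v; the other half leaves
    the decay exp(-a|s|).\<close>
  define a where "a = (\<eta> - \<omega>) / 2"
  have a: "a > 0" using \<omega> by (simp add: a_def)
  have [measurable]: "v \<in> borel_measurable borel" and v1: "\<And>s. 1 \<le> v s"
    using v by (auto simp: admissible_def)
  obtain K where K: "K > 0" "\<And>s. v s \<le> K * exp (a * \<bar>s\<bar>)"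
    using admissible_subexponential[OF v a] by blast
  define J where "J = (\<integral>s. exp (- (2 * a * \<bar>s\<bar>)) \<partial>lborel)"
  have iJ: "integrable lborel (\<lambda>s::real. exp (- (2 * a * \<bar>s\<bar>)))"
    using a by (intro integrable_exp_minus_abs) simp
  have J0: "J \<ge> 0" unfolding J_def by simp
  show ?thesis
  proof (intro exI[of _ "K * sqrt J"] allI impI)
    fix g M assume g [measurable]: "g \<in> borel_measurable borel"
      and bd: "\<forall>s. cmod (g s) \<le> M * exp (- (\<eta> * \<bar>s\<bar>))"
    have M0: "M \<ge> 0" using bd[rule_format, of 0] by simp (meson norm_ge_zero order_trans)
    have wb: "(cmod (wt v \<omega> g s))\<^sup>2 \<le> (K * M)\<^sup>2 * exp (- (2 * a * \<bar>s\<bar>))" for s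
    proof -
      have "cmod (wt v \<omega> g s) = v s * exp (\<omega> * \<bar>s\<bar>) * cmod (g s)"
        using v1[of s] by (simp add: wt_def norm_mult)
      also have "\<dots> \<le> (K * exp (a * \<bar>s\<bar>)) * exp (\<omega> * \<bar>s\<bar>) * (M * exp (- (\<eta> * \<bar>s\<bar>)))"
        using v1[of s] K bd M0 by (intro mult_mono) auto
      also have "\<dots> = K * M * exp (a * \<bar>s\<bar> + \<omega> * \<bar>s\<bar> - \<eta> * \<bar>s\<bar>)"
        by (simp add: exp_add exp_diff exp_minus field_simps)
      also have "a * \<bar>s\<bar> + \<omega> * \<bar>s\<bar> - \<eta> * \<bar>s\<bar> = - (a * \<bar>s\<bar>)"
        by (simp add: a_def field_simps)
      finally have "(cmod (wt v \<omega> g s))\<^sup>2 \<le> (K * M * exp (- (a * \<bar>s\<bar>)))\<^sup>2"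
        by (intro power_mono) auto
      also have "\<dots> = (K * M)\<^sup>2 * exp (- (2 * a * \<bar>s\<bar>))"
        by (simp add: power_mult_distrib exp_double[symmetric] mult.assoc)
      finally show ?thesis .
    qed
    have iK: "integrable lborel (\<lambda>s. (K * M)\<^sup>2 * exp (- (2 * a * \<bar>s\<bar>)))"
      using iJ by (rule integrable_mult_right)
    have iw: "integrable lborel (\<lambda>s. (cmod (wt v \<omega> g s))\<^sup>2)"
      by (rule Bochner_Integration.integrable_bound[OF iK]) (use wb in \<open>auto simp: wt_def\<close>)
    have "(\<integral>s. (cmod (wt v \<omega> g s))\<^sup>2 \<partial>lborel) \<le> (\<integral>s. (K * M)\<^sup>2 * exp (- (2 * a * \<bar>s\<bar>)) \<partial>lborel)"
      by (intro integral_mono iw iK wb)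
    also have "\<dots> = (K * M)\<^sup>2 * J" by (simp add: J_def)
    finally have "sqrt (\<integral>s. (cmod (wt v \<omega> g s))\<^sup>2 \<partial>lborel) \<le> sqrt ((K * M)\<^sup>2 * J)"
      by (rule real_sqrt_le_mono)
    also have "\<dots> = K * sqrt J * M" using K M0 by (simp add: real_sqrt_mult)
    finally show "integrable lborel (\<lambda>s. (cmod (wt v \<omega> g s))\<^sup>2) \<and>
       sqrt (\<integral>s. (cmod (wt v \<omega> g s))\<^sup>2 \<partial>lborel) \<le> K * sqrt J * M"
      using iw by simp
  qed
qed

lemma strip_less:
  assumes "0 \<le> \<omega>" "\<omega> < \<eta>" "z \<in> strip \<omega>"
  shows "\<bar>Im z\<bar> < \<eta>"
  using assms by (auto simp: strip_def split: if_splits)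

lemma Wnorm_le:
  assumes "W_rep v \<omega> f g"
  shows "Wnorm v \<omega> f \<le> sqrt (\<integral>s. (cmod (wt v \<omega> g s))\<^sup>2 \<partial>lborel)"
  unfolding Wnorm_def using assms
  by (intro cInf_lower bdd_belowI[of _ 0]) auto

lemma restr_in_W_iff: "restr \<omega> f \<in> W v \<omega> \<longleftrightarrow> (\<exists>g. W_rep v \<omega> f g)"
  by (auto simp: W_def W_rep_def restr_def)

text \<open>The representative is \<open>strip_symbol \<psi> \<eta>\<close>, whose decay rate \<eta>
  exceeds \<omega>. Since \<open>K\<close> does not depend on \<open>\<psi>\<close>, integral
  convergence to 0 along the two lines forces convergence to 0 in the norm of W.\<close>

lemma holomorphic_in_W:
  assumes v: "admissible v" and \<omega>: "0 \<le> \<omega>" "\<omega> < \<eta>"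
  shows "\<exists>K. \<forall>\<psi> C \<theta>. \<eta> < \<theta> \<longrightarrow> \<psi> holomorphic_on strip \<theta> \<longrightarrow>
      (\<forall>z\<in>strip \<theta>. cmod (\<psi> z) \<le> C / (1 + (Re z)\<^sup>2)) \<longrightarrow>
      restr \<omega> \<psi> \<in> W v \<omega> \<and> Wnorm v \<omega> (restr \<omega> \<psi>) \<le> K * (line_norm \<psi> \<eta> + line_norm \<psi> (-\<eta>))"
proof -
  obtain K where K: "\<And>g M. \<lbrakk>g \<in> borel_measurable borel; \<And>s. cmod (g s) \<le> M * exp (- (\<eta> * \<bar>s\<bar>))\<rbrakk> \<Longrightarrow>
     integrable lborel (\<lambda>s. (cmod (wt v \<omega> g s))\<^sup>2) \<and>
     sqrt (\<integral>s. (cmod (wt v \<omega> g s))\<^sup>2 \<partial>lborel) \<le> K * M"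
    using exp_decay_weighted_norm[OF v \<omega>(2)] by blast
  show ?thesis
  proof (intro exI[of _ K] allI impI)
    fix \<psi> C \<theta>
    assume *: "\<eta> < \<theta>" "\<psi> holomorphic_on strip \<theta>" "\<forall>z\<in>strip \<theta>. cmod (\<psi> z) \<le> C / (1 + (Re z)\<^sup>2)"
    have \<eta>: "0 < \<eta>" using \<omega> by simp
    have bd: "\<And>z. z \<in> strip \<theta> \<Longrightarrow> cmod (\<psi> z) \<le> C / (1 + (Re z)\<^sup>2)" using * by blast
    note L = \<eta> *(1,2) bd
    have k: "integrable lborel (\<lambda>s. (cmod (wt v \<omega> (strip_symbol \<psi> \<eta>) s))\<^sup>2) \<and>
        sqrt (\<integral>s. (cmod (wt v \<omega> (strip_symbol \<psi> \<eta>) s))\<^sup>2 \<partial>lborel)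
        \<le> K * (line_norm \<psi> \<eta> + line_norm \<psi> (-\<eta>))"
      by (intro K measurable_strip_symbol[OF L] norm_strip_symbol_le[OF L])
    have "W_rep v \<omega> (restr \<omega> \<psi>) (strip_symbol \<psi> \<eta>)"
      unfolding W_rep_def
      using k measurable_strip_symbol[OF L] fourier_strip_symbol[OF L] strip_less[OF \<omega>]
      by (auto simp: restr_def)
    then show "restr \<omega> \<psi> \<in> W v \<omega> \<and> Wnorm v \<omega> (restr \<omega> \<psi>) \<le> K * (line_norm \<psi> \<eta> + line_norm \<psi> (-\<eta>))"
      using k Wnorm_le by (fastforce simp: W_def restr_def)
  qed
qed

text \<open>This function decays only like 1 / |z|, too slowly for \<open>holomorphic_in_W\<close>.
  The half-line exponential integral supplies an explicit representative instead, with decay rate Im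
  \<mu>.\<close>

lemma resolvent_in_W:
  assumes v: "admissible v" and \<omega>: "0 \<le> \<omega>" "\<omega> < Im \<mu>"
  shows "restr \<omega> (\<lambda>z. 1 / (\<mu> - z)) \<in> W v \<omega>"
proof -
  define g where "g s = - \<i> * (indicator {0<..} s *\<^sub>R exp (\<i> * of_real s * \<mu>))" for s :: real
  have [measurable]: "g \<in> borel_measurable borel" unfolding g_def by measurable
  have gb: "cmod (g s) \<le> 1 * exp (- (Im \<mu> * \<bar>s\<bar>))" for s
    by (simp add: g_def norm_mult norm_exp_eq_Re indicator_def mult.commute)
  have "integrable lborel (\<lambda>s. (cmod (wt v \<omega> g s))\<^sup>2)"
    using exp_decay_weighted_norm[OF v \<omega>(2)] gb \<open>g \<in> borel_measurable borel\<close> by blast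
  moreover have "1 / (\<mu> - z) = fourier g z" if "z \<in> strip \<omega>" for z
  proof -
    have z: "Im (\<mu> - z) > 0" using strip_less[OF \<omega> that] by simp
    have "fourier g z = (\<integral>s. - \<i> * (indicator {0<..} s *\<^sub>R exp (\<i> * of_real s * (\<mu> - z))) \<partial>lborel)"
      unfolding fourier_def g_def
      by (intro Bochner_Integration.integral_cong) (auto simp: mult_exp_exp algebra_simps)
    also have "\<dots> = - \<i> * (\<i> / (\<mu> - z))"
      by (subst integral_mult_right_zero, subst integral_exp_half_line[OF z]) simp
    finally show ?thesis by simp
  qed
  ultimately show ?thesis
    unfolding restr_in_W_iff W_rep_def by (intro exI[of _ g]) auto
qed

text \<open>On the strip |exp(-isz)| \<le> exp(\<omega>|s|), so the integrand is at most the product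
  of 1/v and the weighted modulus of g. Both are square integrable, the first by strong
  admissibility. This makes \<open>fourier\<close> additive on representatives.\<close>

lemma W_rep_integrable:
  assumes v: "strongly_admissible v" and \<omega>: "\<omega> \<ge> 0" and g: "W_rep v \<omega> f g" and z: "z \<in> strip \<omega>"
  shows "integrable lborel (\<lambda>s. g s * exp (- \<i> * of_real s * z))"
proof (rule Bochner_Integration.integrable_bound)
  have v1: "\<And>s. 1 \<le> v s" using v by (auto simp: strongly_admissible_def admissible_def)
  have [measurable]: "g \<in> borel_measurable borel" using g by (auto simp: W_rep_def)
  show "integrable lborel (\<lambda>s. ((1 / v s)\<^sup>2 + (cmod (wt v \<omega> g s))\<^sup>2) / 2)"
    using v g by (auto simp: strongly_admissible_def W_rep_def)
  show "(\<lambda>s. g s * exp (- \<i> * of_real s * z)) \<in> borel_measurable lborel" by measurable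
  show "AE s in lborel. cmod (g s * exp (- \<i> * of_real s * z))
     \<le> norm (((1 / v s)\<^sup>2 + (cmod (wt v \<omega> g s))\<^sup>2) / 2)"
  proof (rule AE_I2)
    fix s :: real
    have "\<bar>Im z\<bar> \<le> \<omega>" using z \<omega> by (auto simp: strip_def split: if_splits)
    then have "\<bar>Im z\<bar> * \<bar>s\<bar> \<le> \<omega> * \<bar>s\<bar>" by (rule mult_right_mono) simp
    then have "s * Im z \<le> \<omega> * \<bar>s\<bar>"
      using abs_ge_self[of "s * Im z"] by (simp add: abs_mult mult.commute)
    then have "cmod (g s * exp (- \<i> * of_real s * z)) \<le> cmod (g s) * exp (\<omega> * \<bar>s\<bar>)"
      by (simp add: norm_mult norm_exp_eq_Re mult_left_mono)
    also have "\<dots> = (1 / v s) * cmod (wt v \<omega> g s)"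
      using v1[of s] by (simp add: wt_def norm_mult)
    also have "\<dots> \<le> ((1 / v s)\<^sup>2 + (cmod (wt v \<omega> g s))\<^sup>2) / 2"
      using sum_squares_bound[of "1 / v s" "cmod (wt v \<omega> g s)"] by (simp add: mult.commute)
    finally show "cmod (g s * exp (- \<i> * of_real s * z))
      \<le> norm (((1 / v s)\<^sup>2 + (cmod (wt v \<omega> g s))\<^sup>2) / 2)" by simp
  qed
qed

text \<open>Representatives are subtracted: |a - b|^2 \<le> 2 (|a|^2 + |b|^2) bounds the weighted
  norm, and the transform splits by \<open>W_rep_integrable\<close>.\<close>

lemma W_diff:
  assumes v: "strongly_admissible v" and \<omega>: "\<omega> \<ge> 0" and "f1 \<in> W v \<omega>" "f2 \<in> W v \<omega>"
  shows "(\<lambda>z. f1 z - f2 z) \<in> W v \<omega>"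
proof -
  obtain g1 g2 where g: "W_rep v \<omega> f1 g1" "W_rep v \<omega> f2 g2"
    using assms by (auto simp: W_def)
  have [measurable]: "g1 \<in> borel_measurable borel" "g2 \<in> borel_measurable borel" "v \<in> borel_measurable borel"
    using g v by (auto simp: W_rep_def strongly_admissible_def admissible_def)
  have "integrable lborel (\<lambda>s. (cmod (wt v \<omega> (\<lambda>s. g1 s - g2 s) s))\<^sup>2)"
  proof (rule Bochner_Integration.integrable_bound)
    show "integrable lborel (\<lambda>s. 2 * ((cmod (wt v \<omega> g1 s))\<^sup>2 + (cmod (wt v \<omega> g2 s))\<^sup>2))"
      using g by (auto simp: W_rep_def)
    show "(\<lambda>s. (cmod (wt v \<omega> (\<lambda>s. g1 s - g2 s) s))\<^sup>2) \<in> borel_measurable lborel"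
      unfolding wt_def by measurable
    show "AE s in lborel. norm ((cmod (wt v \<omega> (\<lambda>s. g1 s - g2 s) s))\<^sup>2)
      \<le> norm (2 * ((cmod (wt v \<omega> g1 s))\<^sup>2 + (cmod (wt v \<omega> g2 s))\<^sup>2))"
    proof (rule AE_I2)
      fix s
      let ?a = "wt v \<omega> g1 s" and ?b = "wt v \<omega> g2 s"
      have "wt v \<omega> (\<lambda>s. g1 s - g2 s) s = ?a - ?b" by (simp add: wt_def right_diff_distrib)
      then have "(cmod (wt v \<omega> (\<lambda>s. g1 s - g2 s) s))\<^sup>2 \<le> (cmod ?a + cmod ?b)\<^sup>2"
        by (simp add: norm_triangle_ineq4 power_mono)
      also have "\<dots> \<le> 2 * ((cmod ?a)\<^sup>2 + (cmod ?b)\<^sup>2)"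
        using sum_squares_bound[of "cmod ?a" "cmod ?b"] by (simp add: power2_sum)
      finally show "norm ((cmod (wt v \<omega> (\<lambda>s. g1 s - g2 s) s))\<^sup>2)
        \<le> norm (2 * ((cmod ?a)\<^sup>2 + (cmod ?b)\<^sup>2))" by simp
    qed
  qed
  moreover have "f1 z - f2 z = fourier (\<lambda>s. g1 s - g2 s) z" if "z \<in> strip \<omega>" for z
    using g that W_rep_integrable[OF v \<omega> g(1) that] W_rep_integrable[OF v \<omega> g(2) that]
    by (simp add: W_rep_def fourier_def left_diff_distrib)
  ultimately have "W_rep v \<omega> (\<lambda>z. f1 z - f2 z) (\<lambda>s. g1 s - g2 s)"
    unfolding W_rep_def by auto
  then show ?thesis using assms by (auto simp: W_def)
qed

lemma Wnorm_nonneg: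
  assumes "f \<in> W v \<omega>"
  shows "Wnorm v \<omega> f \<ge> 0"
  unfolding Wnorm_def using assms by (intro cInf_greatest) (auto simp: W_def)

text \<open>Decay of order 2 suffices for \<open>holomorphic_in_W\<close>, because 1 + x^2 \<le> (1
  + |x|)^2. The lines of integration lie midway between the boundaries of the two strips.\<close>

lemma Hinf0_closed_in_W:
  assumes v: "admissible v" and \<omega>: "0 \<le> \<omega>" and \<psi>: "\<psi> \<in> Hinf0_closed \<omega>"
  shows "restr \<omega> \<psi> \<in> W v \<omega>"
proof -
  obtain \<theta> where \<theta>: "\<omega> < \<theta>" and H: "\<psi> \<in> Hinf0 \<theta>"
    using \<psi> by (auto simp: Hinf0_closed_def)
  have "\<forall>\<alpha>>0. \<exists>C. \<forall>z\<in>strip \<theta>. cmod (\<psi> z) \<le> C * (1 + \<bar>Re z\<bar>) powr (- \<alpha>)"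
    using H by (simp add: Hinf0_def)
  then obtain C where C: "\<And>z. z \<in> strip \<theta> \<Longrightarrow> cmod (\<psi> z) \<le> C * (1 + \<bar>Re z\<bar>) powr (- 2)"
    using zero_less_numeral by blast
  have "0 \<in> strip \<theta>" using \<theta> \<omega> by (simp add: strip_pos)
  from C[OF this] have C0: "C \<ge> 0" by simp (meson norm_ge_zero order_trans)
  have "cmod (\<psi> z) \<le> C / (1 + (Re z)\<^sup>2)" if "z \<in> strip \<theta>" for z
  proof -
    have "(1 + \<bar>Re z\<bar>) powr (- 2) = 1 / (1 + \<bar>Re z\<bar>)\<^sup>2"
      by (simp add: powr_minus_divide)
    also have "\<dots> \<le> 1 / (1 + (Re z)\<^sup>2)"
      by (intro divide_left_mono) (auto simp: power2_sum intro!: mult_pos_pos add_pos_nonneg)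
    finally have "C * (1 + \<bar>Re z\<bar>) powr (- 2) \<le> C * (1 / (1 + (Re z)\<^sup>2))"
      using C0 by (rule mult_left_mono)
    then show ?thesis using C[OF that] by simp
  qed
  moreover have "\<omega> < (\<omega> + \<theta>) / 2" "(\<omega> + \<theta>) / 2 < \<theta>" using \<theta> by auto
  moreover have "\<psi> holomorphic_on strip \<theta>" using H by (simp add: Hinf0_def)
  ultimately show ?thesis
    using holomorphic_in_W[OF v \<omega>] by blast
qed

lemma norm_gauss: "cmod (gauss z) = exp ((Im z)\<^sup>2 - (Re z)\<^sup>2)"
  by (simp add: gauss_def norm_exp_eq_Re Re_power2)

text \<open>The bound exp(x^2) \<ge> 1 + x^2 turns Gaussian decay into the quadratic decay that
  \<open>holomorphic_in_W\<close> asks for.\<close>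

lemma gauss_in_W:
  assumes v: "admissible v" and \<omega>: "0 \<le> \<omega>"
  shows "restr \<omega> gauss \<in> W v \<omega>"
proof -
  have "cmod (gauss z) \<le> exp ((\<omega> + 2)\<^sup>2) / (1 + (Re z)\<^sup>2)" if "z \<in> strip (\<omega> + 2)" for z
  proof -
    have "\<bar>Im z\<bar> \<le> \<bar>\<omega> + 2\<bar>" using that \<omega> by (simp add: strip_pos)
    then have "(Im z)\<^sup>2 \<le> (\<omega> + 2)\<^sup>2" by (simp only: abs_le_square_iff)
    then have "cmod (gauss z) \<le> exp ((\<omega> + 2)\<^sup>2 - (Re z)\<^sup>2)"
      by (simp add: norm_gauss)
    also have "\<dots> = exp ((\<omega> + 2)\<^sup>2) / exp ((Re z)\<^sup>2)" by (rule exp_diff)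
    also have "\<dots> \<le> exp ((\<omega> + 2)\<^sup>2) / (1 + (Re z)\<^sup>2)"
      by (intro divide_left_mono exp_ge_add_one_self) (auto intro!: mult_pos_pos add_pos_nonneg)
    finally show ?thesis .
  qed
  moreover have "gauss holomorphic_on strip (\<omega> + 2)"
    unfolding gauss_def by (intro holomorphic_intros)
  moreover have "\<omega> < \<omega> + 1" "\<omega> + 1 < \<omega> + 2" by auto
  ultimately show ?thesis
    using holomorphic_in_W[OF v \<omega>] by blast
qed

subsection \<open>The calculus and injectivity of the Gaussian\<close>

lemma W_calculus_bounded_op:
  "W_calculus v \<omega> DA A \<Psi> \<Longrightarrow> f \<in> W v \<omega> \<Longrightarrow> bounded_op (\<Psi> f)"
  by (simp add: W_calculus_def)

lemma W_calculus_mult: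
  assumes "W_calculus v \<omega> DA A \<Psi>" "restr \<omega> f \<in> W v \<omega>" "restr \<omega> g \<in> W v \<omega>"
  shows "\<Psi> (restr \<omega> (\<lambda>z. f z * g z)) x = \<Psi> (restr \<omega> f) (\<Psi> (restr \<omega> g) x)"
proof -
  have "\<Psi> (\<lambda>z. restr \<omega> f z * restr \<omega> g z) = \<Psi> (restr \<omega> f) \<circ> \<Psi> (restr \<omega> g)"
    using assms by (simp add: W_calculus_def)
  moreover have "(\<lambda>z. restr \<omega> f z * restr \<omega> g z) = restr \<omega> (\<lambda>z. f z * g z)"
    by (auto simp: restr_def)
  ultimately show ?thesis by simp
qed

text \<open>Additivity is applied to (f - g) + g = f; this is why membership is asked of f - g and
  g.\<close>

lemma W_calculus_diff:
  assumes "W_calculus v \<omega> DA A \<Psi>" "restr \<omega> (\<lambda>z. f z - g z) \<in> W v \<omega>" "restr \<omega> g \<in> W v \<omega>"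
  shows "\<Psi> (restr \<omega> (\<lambda>z. f z - g z)) x = \<Psi> (restr \<omega> f) x - \<Psi> (restr \<omega> g) x"
proof -
  have "\<Psi> (\<lambda>z. restr \<omega> (\<lambda>z. f z - g z) z + restr \<omega> g z)
      = (\<lambda>x. \<Psi> (restr \<omega> (\<lambda>z. f z - g z)) x + \<Psi> (restr \<omega> g) x)"
    using assms by (simp add: W_calculus_def)
  moreover have "(\<lambda>z. restr \<omega> (\<lambda>z. f z - g z) z + restr \<omega> g z) = restr \<omega> f"
    by (auto simp: restr_def)
  ultimately show ?thesis by simp
qed

lemma W_calculus_tendsto_0:
  assumes cal: "W_calculus v \<omega> DA A \<Psi>" and f: "\<And>n. f n \<in> W v \<omega>"
    and lim: "(\<lambda>n. Wnorm v \<omega> (f n)) \<longlonglongrightarrow> 0"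
  shows "(\<lambda>n. \<Psi> (f n) x) \<longlonglongrightarrow> 0"
proof -
  obtain C where C: "\<And>f. f \<in> W v \<omega> \<Longrightarrow> onorm (\<Psi> f) \<le> C * Wnorm v \<omega> f"
    using cal unfolding W_calculus_def by blast
  have bound: "norm (\<Psi> (f n) x) \<le> C * Wnorm v \<omega> (f n) * norm x" for n
  proof -
    have "bounded_linear (\<Psi> (f n))"
      using W_calculus_bounded_op[OF cal f] by (simp add: bounded_op_def)
    then have "norm (\<Psi> (f n) x) \<le> onorm (\<Psi> (f n)) * norm x" by (rule onorm)
    also have "\<dots> \<le> C * Wnorm v \<omega> (f n) * norm x" by (intro mult_right_mono C f) simp
    finally show ?thesis .
  qed
  show ?thesis
  proof (rule Lim_null_comparison)
    show "\<forall>\<^sub>F n in sequentially. norm (\<Psi> (f n) x) \<le> C * Wnorm v \<omega> (f n) * norm x"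
      using bound by simp
    show "(\<lambda>n. C * Wnorm v \<omega> (f n) * norm x) \<longlonglongrightarrow> 0"
      using tendsto_mult_right[OF tendsto_mult_left[OF lim, of C], of "norm x"] by simp
  qed
qed

text \<open>x is recovered as \<mu> R x - A (R x), which is 0 when R x = 0.\<close>

lemma resolvent_injective:
  assumes "lin_op DA A" "is_resolvent DA A \<mu> R" "R x = 0"
  shows "x = 0"
proof -
  have "A (0 + 0) = A 0 + A 0" using assms(1) unfolding lin_op_def by blast
  then have "A 0 = 0" by simp
  moreover have "cscale \<mu> (0::'a) = 0" using norm_cscale[of \<mu> "0::'a"] by simp
  moreover have "cscale \<mu> (R x) - A (R x) = x" using assms(2) by (simp add: is_resolvent_def)
  ultimately show ?thesis using assms(3) by simp
qed

section \<open>Taylor polynomials of exp(z^2) damped by the Gaussian\<close>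

definition exp_sq_partial :: "nat \<Rightarrow> complex \<Rightarrow> complex" where
  "exp_sq_partial N z = (\<Sum>k\<le>N. (z\<^sup>2) ^ k /\<^sub>R fact k)"

lemma exp_sq_partial_tendsto: "(\<lambda>N. exp_sq_partial N z) \<longlonglongrightarrow> exp (z\<^sup>2)"
  using exp_converges[of "z\<^sup>2"] unfolding sums_def_le exp_sq_partial_def .

text \<open>In modulus the Taylor polynomial is at most exp(|z|^2), and the Gaussian cancels the
  growth in Re z. The bound depends on Im z alone, hence is uniform in N on every strip.\<close>

lemma norm_gauss_exp_sq_partial_le: "cmod (gauss z * exp_sq_partial N z) \<le> exp (2 * (Im z)\<^sup>2)"
proof -
  have "cmod (exp_sq_partial N z) \<le> (\<Sum>k\<le>N. ((cmod z)\<^sup>2) ^ k /\<^sub>R fact k)"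
    unfolding exp_sq_partial_def
    by (rule order_trans[OF norm_sum]) (simp add: norm_power)
  also have "\<dots> \<le> exp ((cmod z)\<^sup>2)"
    unfolding exp_def by (intro sum_le_suminf summable_exp_generic) auto
  finally have "cmod (gauss z * exp_sq_partial N z) \<le> exp ((Im z)\<^sup>2 - (Re z)\<^sup>2) * exp ((cmod z)\<^sup>2)"
    unfolding norm_mult norm_gauss by (intro mult_left_mono) auto
  also have "\<dots> = exp (2 * (Im z)\<^sup>2)"
    by (simp add: mult_exp_exp cmod_power2)
  finally show ?thesis .
qed

lemma exp_sq_partial_holomorphic: "exp_sq_partial N holomorphic_on S"
  unfolding exp_sq_partial_def scaleR_conv_of_real by (intro holomorphic_intros)

text \<open>The functions \<open>G p\<^sub>N\<close>, with \<open>p\<^sub>N\<close> the Taylor polynomials of \<open>exp (z\<^sup>2)\<close>, are bounded on strips uniformly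
  in \<open>N\<close> and tend to 1, hence \<open>G p\<^sub>N r\<^sup>2\<close> tends to \<open>r\<^sup>2\<close> in the algebra, where \<open>r\<close> is a resolvent function.
  If \<open>\<Psi>(G)\<close> annihilates \<open>x\<close>, then so does every \<open>\<Psi>(G p\<^sub>N r\<^sup>2)\<close>: after multiplication with
  a high power of \<open>r\<close> the factor \<open>p\<^sub>N\<close> belongs to the algebra, and \<open>\<Psi>(r)\<close> is injective.\<close>

lemma W_calculus_gauss_injective:
  fixes \<Psi> :: "(complex \<Rightarrow> complex) \<Rightarrow> 'x::cbanach \<Rightarrow> 'x"
  assumes \<omega>: "\<omega> \<ge> 0" and v: "admissible v" and lin: "lin_op DA A"
    and cal: "W_calculus v \<omega> DA A \<Psi>" and x0: "\<Psi> (restr \<omega> gauss) x = 0"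
  shows "x = 0"
proof -
  \<comment> \<open>Nested heights: \<omega> for the algebra, \<omega> + 1 for the lines of
    integration, \<omega> + 2 for the strip of holomorphy, \<omega> + 3 for the pole of
    \<open>r\<close>.\<close>
  define \<eta> \<theta> where "\<eta> = \<omega> + 1" and "\<theta> = \<omega> + 2"
  have \<theta>: "\<theta> > 0" "\<eta> < \<theta>" "\<omega> < \<eta>" "0 < \<eta>" using \<omega> by (auto simp: \<eta>_def \<theta>_def)
  \<comment> \<open>The pole lies on the imaginary axis at distance 1 from the strip of height
    \<theta>, so that |r|^2 \<le> 1 / (1 + (Re z)^2) and |r| \<le> 1 hold there without further
    constants.\<close>
  define \<mu> where "\<mu> = \<i> * of_real (\<omega> + 3)"
  define r where "r z = 1 / (\<mu> - z)" for z
  define R where "R = \<Psi> (restr \<omega> r)"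
  have Im\<mu>: "Im \<mu> = \<omega> + 3" "Re \<mu> = 0" by (auto simp: \<mu>_def)
  have rW: "restr \<omega> r \<in> W v \<omega>"
    unfolding r_def by (rule resolvent_in_W[OF v \<omega>]) (simp add: Im\<mu>)
  have res: "is_resolvent DA A \<mu> R"
    using cal \<omega> unfolding W_calculus_def R_def r_def by (simp add: Im\<mu>)
  have Rinj: "y = 0" if "R y = 0" for y
    by (rule resolvent_injective[OF lin res that])
  have ne: "\<mu> - z \<noteq> 0" if "z \<in> strip \<theta>" for z
    using that \<theta> Im\<mu> by (auto simp: strip_pos \<theta>_def complex_eq_iff)
  have r2: "(cmod (r z))\<^sup>2 \<le> 1 / (1 + (Re z)\<^sup>2)" if z: "z \<in> strip \<theta>" for z
  proof -
    have "1 \<le> Im (\<mu> - z)" using z \<theta> by (auto simp: strip_pos Im\<mu> \<theta>_def)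
    then have "1 \<le> (Im (\<mu> - z))\<^sup>2" by (simp add: one_le_power)
    then have "1 + (Re z)\<^sup>2 \<le> (cmod (\<mu> - z))\<^sup>2"
      unfolding cmod_power2 by (simp add: Im\<mu>)
    then have "1 / (cmod (\<mu> - z))\<^sup>2 \<le> 1 / (1 + (Re z)\<^sup>2)"
      by (intro divide_left_mono) (use ne[OF z] in \<open>auto intro!: mult_pos_pos add_pos_nonneg\<close>)
    then show ?thesis by (simp add: r_def norm_divide power_divide)
  qed
  have r1: "cmod (r z) \<le> 1" if z: "z \<in> strip \<theta>" for z
  proof -
    have "(cmod (r z))\<^sup>2 \<le> 1" by (rule order_trans[OF r2[OF z]]) (simp add: divide_le_eq_1 add_pos_nonneg)
    then show ?thesis by (simp add: abs_square_le_1)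
  qed
  have holr: "r holomorphic_on strip \<theta>"
    unfolding r_def using ne by (intro holomorphic_intros) auto
  obtain K where K: "\<And>\<psi> C. \<lbrakk>\<psi> holomorphic_on strip \<theta>;
      \<And>z. z \<in> strip \<theta> \<Longrightarrow> cmod (\<psi> z) \<le> C / (1 + (Re z)\<^sup>2)\<rbrakk> \<Longrightarrow>
      restr \<omega> \<psi> \<in> W v \<omega> \<and> Wnorm v \<omega> (restr \<omega> \<psi>) \<le> K * (line_norm \<psi> \<eta> + line_norm \<psi> (-\<eta>))"
    using holomorphic_in_W[OF v \<omega> \<theta>(3)] \<theta>(2) by blast
  \<comment> \<open>Two factors \<open>r\<close> supply the quadratic decay; a bounded holomorphic
    function times r^2 therefore lies in the algebra.\<close>
  have decay: "cmod (\<phi> z * (r z)\<^sup>2) \<le> B / (1 + (Re z)\<^sup>2)"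
    if "cmod (\<phi> z) \<le> B" "z \<in> strip \<theta>" for \<phi> :: "complex \<Rightarrow> complex" and B z
  proof -
    have "B \<ge> 0" using that(1) norm_ge_zero order_trans by blast
    then have "cmod (\<phi> z) * (cmod (r z))\<^sup>2 \<le> B * (1 / (1 + (Re z)\<^sup>2))"
      using that r2[OF that(2)] by (intro mult_mono) auto
    then show ?thesis by (simp add: norm_mult norm_power)
  qed
  have inW: "restr \<omega> (\<lambda>z. \<phi> z * (r z)\<^sup>2) \<in> W v \<omega>"
    and nW: "Wnorm v \<omega> (restr \<omega> (\<lambda>z. \<phi> z * (r z)\<^sup>2)) \<le>
        K * (line_norm (\<lambda>z. \<phi> z * (r z)\<^sup>2) \<eta> + line_norm (\<lambda>z. \<phi> z * (r z)\<^sup>2) (-\<eta>))"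
    if hol: "\<phi> holomorphic_on strip \<theta>" and bd: "\<And>z. z \<in> strip \<theta> \<Longrightarrow> cmod (\<phi> z) \<le> B" for \<phi> B
  proof -
    have "(\<lambda>z. \<phi> z * (r z)\<^sup>2) holomorphic_on strip \<theta>"
      using hol holr by (intro holomorphic_intros)
    moreover have "cmod (\<phi> z * (r z)\<^sup>2) \<le> B / (1 + (Re z)\<^sup>2)" if z: "z \<in> strip \<theta>" for z
      by (rule decay[where \<phi> = \<phi>, OF bd[OF z] z])
    ultimately have "restr \<omega> (\<lambda>z. \<phi> z * (r z)\<^sup>2) \<in> W v \<omega> \<and>
      Wnorm v \<omega> (restr \<omega> (\<lambda>z. \<phi> z * (r z)\<^sup>2)) \<le>
        K * (line_norm (\<lambda>z. \<phi> z * (r z)\<^sup>2) \<eta> + line_norm (\<lambda>z. \<phi> z * (r z)\<^sup>2) (-\<eta>))"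
      by (rule K)
    then show "restr \<omega> (\<lambda>z. \<phi> z * (r z)\<^sup>2) \<in> W v \<omega>"
      "Wnorm v \<omega> (restr \<omega> (\<lambda>z. \<phi> z * (r z)\<^sup>2)) \<le>
        K * (line_norm (\<lambda>z. \<phi> z * (r z)\<^sup>2) \<eta> + line_norm (\<lambda>z. \<phi> z * (r z)\<^sup>2) (-\<eta>))"
      by blast+
  qed
  define g where "g N z = gauss z * exp_sq_partial N z" for N z
  have holg: "g N holomorphic_on strip \<theta>" for N
    unfolding g_def gauss_def by (intro holomorphic_intros exp_sq_partial_holomorphic)
  define M where "M = exp (2 * \<theta>\<^sup>2)"
  have gM: "cmod (g N z) \<le> M" if "z \<in> strip \<theta>" for N z
  proof -
    have "\<bar>Im z\<bar> \<le> \<bar>\<theta>\<bar>" using that \<theta> by (simp add: strip_pos)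
    then have "(Im z)\<^sup>2 \<le> \<theta>\<^sup>2" by (simp only: abs_le_square_iff)
    then show ?thesis
      using norm_gauss_exp_sq_partial_le[of z N] unfolding g_def M_def
      by (meson exp_le_cancel_iff mult_le_cancel_left_pos order_trans zero_less_numeral)
  qed
  \<comment> \<open>\<open>j\<close> counts the surplus resolvent factors: raising it by one amounts
    to one more application of \<open>R\<close>.\<close>
  define E where "E N j z = ((r z)^j * g N z) * (r z)\<^sup>2" for N j z
  have EW: "restr \<omega> (E N j) \<in> W v \<omega>" for N j
    unfolding E_def
  proof (rule inW[where B = M])
    show "(\<lambda>z. r z ^ j * g N z) holomorphic_on strip \<theta>"
      using holr holg[of N] by (intro holomorphic_intros)
    show "cmod (r z ^ j * g N z) \<le> M" if "z \<in> strip \<theta>" for z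
    proof -
      have "cmod (r z) ^ j * cmod (g N z) \<le> 1 * M"
        using r1[OF that] gM[OF that] by (intro mult_mono power_le_one) auto
      then show ?thesis by (simp add: norm_mult norm_power)
    qed
  qed
  have step: "\<Psi> (restr \<omega> (E N (Suc j))) x = R (\<Psi> (restr \<omega> (E N j)) x)" for N j
  proof -
    have "E N (Suc j) = (\<lambda>z. r z * E N j z)" by (auto simp: E_def mult.assoc)
    then show ?thesis using W_calculus_mult[OF cal rW EW] by (simp add: R_def)
  qed
  \<comment> \<open>With j = 2N the surplus factors match the degree 2N of the Taylor polynomial. So
    the product splits inside the algebra into \<open>h\<close> and the Gaussian, and the Gaussian
    annihilates x.\<close>
  have top: "\<Psi> (restr \<omega> (E N (2 * N))) x = 0" for N
  proof -
    define h where "h z = (exp_sq_partial N z * (r z)^(2 * N)) * (r z)\<^sup>2" for z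
    have hW: "restr \<omega> h \<in> W v \<omega>"
      unfolding h_def
    proof (rule inW[where B = "\<Sum>k\<le>N. (1 + \<theta>\<^sup>2) ^ k"])
      show "(\<lambda>z. exp_sq_partial N z * r z ^ (2 * N)) holomorphic_on strip \<theta>"
        using holr by (intro holomorphic_intros exp_sq_partial_holomorphic)
      fix z assume z: "z \<in> strip \<theta>"
      \<comment> \<open>On the strip |z|^2 \<le> (1 + \<theta>^2)(1 + (Re z)^2), and the second
        factor is cancelled by |r|^2.\<close>
      have zr: "(cmod z)\<^sup>2 * (cmod (r z))\<^sup>2 \<le> 1 + \<theta>\<^sup>2"
      proof -
        have "\<bar>Im z\<bar> \<le> \<bar>\<theta>\<bar>" using z \<theta> by (simp add: strip_pos)
        then have "(Im z)\<^sup>2 \<le> \<theta>\<^sup>2" by (simp only: abs_le_square_iff)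
        then have "(cmod z)\<^sup>2 \<le> (1 + \<theta>\<^sup>2) * (1 + (Re z)\<^sup>2)"
          unfolding cmod_power2 by (simp add: distrib_left distrib_right)
            (smt (verit) mult_nonneg_nonneg zero_le_power2)
        then have "(cmod z)\<^sup>2 * (cmod (r z))\<^sup>2 \<le> ((1 + \<theta>\<^sup>2) * (1 + (Re z)\<^sup>2)) * (1 / (1 + (Re z)\<^sup>2))"
          using r2[OF z] by (intro mult_mono) auto
        also have "\<dots> = 1 + \<theta>\<^sup>2"
          using add_pos_nonneg[of 1 "(Re z)\<^sup>2"] by (simp add: field_simps)
        finally show ?thesis .
      qed
      have "cmod (((z\<^sup>2) ^ k /\<^sub>R fact k) * r z ^ (2 * N)) \<le> (1 + \<theta>\<^sup>2) ^ k" if k: "k \<le> N" for k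
      proof -
        \<comment> \<open>Of the 2N factors \<open>r\<close>, 2k are paired with z^(2k); the
          remaining ones have modulus at most 1.\<close>
        have "2 * N = 2 * k + 2 * (N - k)" using k by simp
        then have "cmod (r z) ^ (2 * N) = ((cmod (r z))\<^sup>2) ^ k * cmod (r z) ^ (2 * (N - k))"
          by (metis power_add power_mult)
        then have "cmod (((z\<^sup>2) ^ k /\<^sub>R fact k) * r z ^ (2 * N))
            = ((cmod z)\<^sup>2 * (cmod (r z))\<^sup>2) ^ k * (cmod (r z) ^ (2 * (N - k)) * inverse (fact k))"
          by (simp add: norm_mult norm_power power_mult_distrib)
        also have "\<dots> \<le> (1 + \<theta>\<^sup>2) ^ k * (1 * 1)"
          using zr r1[OF z] by (intro mult_mono power_mono power_le_one) (auto simp: inverse_le_1_iff)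
        finally show ?thesis by simp
      qed
      then show "cmod (exp_sq_partial N z * r z ^ (2 * N)) \<le> (\<Sum>k\<le>N. (1 + \<theta>\<^sup>2) ^ k)"
        unfolding exp_sq_partial_def sum_distrib_right
        by (intro order_trans[OF norm_sum] sum_mono) auto
    qed
    have "E N (2 * N) = (\<lambda>z. h z * gauss z)" by (auto simp: E_def h_def g_def)
    then have "\<Psi> (restr \<omega> (E N (2 * N))) x = \<Psi> (restr \<omega> h) 0"
      using W_calculus_mult[OF cal hW gauss_in_W[OF v \<omega>]] x0 by simp
    also have "\<dots> = 0"
      using W_calculus_bounded_op[OF cal hW] by (simp add: bounded_op_def linear_simps)
    finally show ?thesis .
  qed
  \<comment> \<open>Injectivity of \<open>R\<close> strips off the surplus resolvent factors one at
    a time.\<close>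
  have "\<Psi> (restr \<omega> (E N j)) x = 0 \<Longrightarrow> \<Psi> (restr \<omega> (E N 0)) x = 0" for N j
    by (induction j) (use step Rinj in auto)
  then have E0: "\<Psi> (restr \<omega> (E N 0)) x = 0" for N using top by blast
  define d where "d N z = 1 * (r z)\<^sup>2 - g N z * (r z)\<^sup>2" for N z
  have d_eq: "d N = (\<lambda>z. (1 - g N z) * (r z)\<^sup>2)" for N
    by (auto simp: d_def algebra_simps)
  have hol1: "(\<lambda>z. 1 - g N z) holomorphic_on strip \<theta>" for N
    using holg[of N] by (intro holomorphic_intros)
  have b1: "cmod (1 - g N z) \<le> 1 + M" if "z \<in> strip \<theta>" for N z
    using norm_triangle_ineq4[of 1 "g N z"] gM[OF that, of N] by simp
  have dW: "restr \<omega> (d N) \<in> W v \<omega>" for N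
    unfolding d_eq by (rule inW[OF hol1 b1])
  have dn: "Wnorm v \<omega> (restr \<omega> (d N)) \<le> K * (line_norm (d N) \<eta> + line_norm (d N) (-\<eta>))" for N
    unfolding d_eq by (rule nW[OF hol1 b1])
  \<comment> \<open>Dominated convergence along the line: the integrand tends to 0 pointwise because
    the Taylor polynomials tend to exp(z^2), the reciprocal of the Gaussian.\<close>
  have line0: "(\<lambda>N. line_norm (d N) y) \<longlonglongrightarrow> 0" if y: "\<bar>y\<bar> < \<theta>" for y
  proof -
    have ys: "of_real t + \<i> * of_real y \<in> strip \<theta>" for t :: real using y \<theta> by (simp add: strip_pos)
    have dec: "cmod (d N z) \<le> (1 + M) / (1 + (Re z)\<^sup>2)" if "z \<in> strip \<theta>" for N z
      unfolding d_eq by (rule decay[where \<phi> = "\<lambda>z. 1 - g N z", OF b1[OF that] that])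
    have hold: "d N holomorphic_on strip \<theta>" for N
      unfolding d_eq using holg[of N] holr by (intro holomorphic_intros)
    have "(\<lambda>N. \<integral>t. cmod (d N (of_real t + \<i> * of_real y)) \<partial>lborel) \<longlonglongrightarrow> integral\<^sup>L lborel (\<lambda>t::real. 0::real)"
    proof (rule integral_dominated_convergence[where w = "\<lambda>t. (1 + M) * (1 / (1 + t\<^sup>2))"])
      show "integrable lborel (\<lambda>t. (1 + M) * (1 / (1 + t\<^sup>2)))"
        using integrable_inverse_1_plus_sq by (rule integrable_mult_right)
      show "(\<lambda>t. cmod (d N (of_real t + \<i> * of_real y))) \<in> borel_measurable lborel" for N
        by (intro borel_measurable_norm borel_measurable_integrable
              integrable_norm integrable_on_line[OF \<theta>(1) hold y dec])
      show "AE t in lborel. (\<lambda>N. cmod (d N (of_real t + \<i> * of_real y))) \<longlonglongrightarrow> 0"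
      proof (rule AE_I2)
        fix t :: real
        let ?z = "complex_of_real t + \<i> * of_real y"
        have "(\<lambda>N. (1 - gauss ?z * exp_sq_partial N ?z) * (r ?z)\<^sup>2) \<longlonglongrightarrow> (1 - gauss ?z * exp (?z\<^sup>2)) * (r ?z)\<^sup>2"
          by (intro tendsto_intros exp_sq_partial_tendsto)
        moreover have "gauss ?z * exp (?z\<^sup>2) = 1" by (simp add: gauss_def mult_exp_exp)
        ultimately have "(\<lambda>N. d N ?z) \<longlonglongrightarrow> 0" by (simp add: d_eq g_def)
        then show "(\<lambda>N. cmod (d N ?z)) \<longlonglongrightarrow> 0" by (rule tendsto_norm_zero)
      qed
      show "AE t in lborel. norm (cmod (d N (of_real t + \<i> * of_real y))) \<le> (1 + M) * (1 / (1 + t\<^sup>2))" for N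
        using dec[OF ys] by (intro AE_I2) simp
    qed auto
    then show ?thesis by (simp add: line_norm_def)
  qed
  have "(\<lambda>N. Wnorm v \<omega> (restr \<omega> (d N))) \<longlonglongrightarrow> 0"
  proof (rule tendsto_sandwich)
    show "\<forall>\<^sub>F N in sequentially. 0 \<le> Wnorm v \<omega> (restr \<omega> (d N))"
      using Wnorm_nonneg[OF dW] by simp
    show "\<forall>\<^sub>F N in sequentially. Wnorm v \<omega> (restr \<omega> (d N)) \<le> K * (line_norm (d N) \<eta> + line_norm (d N) (-\<eta>))"
      using dn by simp
    have "(\<lambda>N. K * (line_norm (d N) \<eta> + line_norm (d N) (-\<eta>))) \<longlonglongrightarrow> K * (0 + 0)"
      using \<theta> by (intro tendsto_intros line0) auto
    then show "(\<lambda>N. K * (line_norm (d N) \<eta> + line_norm (d N) (-\<eta>))) \<longlonglongrightarrow> 0" by simp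
  qed simp
  from W_calculus_tendsto_0[OF cal dW this]
  have "(\<lambda>N. \<Psi> (restr \<omega> (d N)) x) \<longlonglongrightarrow> 0" .
  \<comment> \<open>The part containing the Gaussian annihilates x, so only r^2 is left. The
    sequence is thus constant, with value R (R x), and has limit 0.\<close>
  moreover have "\<Psi> (restr \<omega> (d N)) x = R (R x)" for N
  proof -
    have e: "E N 0 = (\<lambda>z. g N z * (r z)\<^sup>2)" by (auto simp: E_def)
    have "\<Psi> (restr \<omega> (d N)) x = \<Psi> (restr \<omega> (\<lambda>z. 1 * (r z)\<^sup>2)) x - \<Psi> (restr \<omega> (E N 0)) x"
      unfolding d_def[abs_def] e
      by (rule W_calculus_diff[OF cal]) (use dW[of N] EW[of N 0] in \<open>simp_all only: d_def[abs_def] e\<close>)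
    also have "\<dots> = \<Psi> (restr \<omega> (\<lambda>z. r z * r z)) x" by (simp add: E0 power2_eq_square)
    also have "\<dots> = R (R x)" using W_calculus_mult[OF cal rW rW] by (simp add: R_def)
    finally show ?thesis .
  qed
  ultimately have "R (R x) = 0" by (simp add: LIMSEQ_const_iff)
  then show ?thesis using Rinj by blast
qed

subsection \<open>Strong convergence\<close>

lemma bounded_linear_eq_on_dense_span:
  assumes f: "bounded_linear f" and g: "bounded_linear g"
    and S: "closure (span S) = UNIV" and eq: "\<And>x. x \<in> S \<Longrightarrow> f x = g x"
  shows "f x = g x"
proof -
  have "f y = g y" if "y \<in> span S" for y
    using linear_eq_on_span[OF bounded_linear.linear[OF f] bounded_linear.linear[OF g] eq that] by blast
  then have "span S \<subseteq> {y. f y = g y}" by blast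
  moreover have "closed {y. f y = g y}"
    using f g by (intro closed_Collect_eq) (auto simp: linear_continuous_on)
  ultimately have "closure (span S) \<subseteq> {y. f y = g y}" by (rule closure_minimal)
  then show ?thesis using S by auto
qed

text \<open>The points of convergence form a subspace, and the uniform bound makes this subspace
  closed by a three-epsilon argument in the complete target space. The bound passes to the limit
  operator.\<close>

lemma uniformly_bounded_strong_limit:
  fixes T :: "nat \<Rightarrow> 'a::real_normed_vector \<Rightarrow> 'b::banach"
  assumes T: "\<And>n. bounded_linear (T n)" and C: "\<And>n. onorm (T n) \<le> C"
    and S: "closure (span S) = UNIV" and conv: "\<And>x. x \<in> S \<Longrightarrow> convergent (\<lambda>n. T n x)"
  shows "\<exists>L. bounded_linear L \<and> (\<forall>x. (\<lambda>n. T n x) \<longlonglongrightarrow> L x)"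
proof -
  note lin = bounded_linear.linear[OF T]
  have C0: "C \<ge> 0" using C[of 0] onorm_pos_le[OF T[of 0]] by simp
  have nT: "norm (T n x) \<le> C * norm x" for n x
    using onorm[OF T, of n x] mult_right_mono[OF C, of "norm x" n] by simp
  have scale: "convergent (\<lambda>n. c *\<^sub>R T n x)" if "convergent (\<lambda>n. T n x)" for c x
    using that unfolding convergent_def by (auto intro: exI tendsto_scaleR[OF tendsto_const])
  have "subspace {x. convergent (\<lambda>n. T n x)}"
    by (auto simp: subspace_def linear_0[OF lin] linear_add[OF lin] linear_scale[OF lin]
        convergent_const intro: convergent_add scale)
  then have span: "convergent (\<lambda>n. T n x)" if "x \<in> span S" for x
    using span_minimal[of S "{x. convergent (\<lambda>n. T n x)}"] conv that by blast
  have all: "convergent (\<lambda>n. T n x)" for x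
  proof -
    have "Cauchy (\<lambda>n. T n x)"
    proof (rule metric_CauchyI)
      fix e :: real assume e: "e > 0"
      \<comment> \<open>The denominator has C + 1 in place of C because C may be 0.\<close>
      define \<delta> where "\<delta> = e / (3 * (C + 1))"
      have \<delta>: "\<delta> > 0" using e C0 by (simp add: \<delta>_def)
      have "x \<in> closure (span S)" using S by simp
      then obtain y where y: "y \<in> span S" "dist y x < \<delta>"
        using \<delta> by (meson closure_approachable)
      have Cy: "C * norm (y - x) < e / 3"
      proof -
        have "C * norm (y - x) \<le> C * \<delta>" using y C0 by (intro mult_left_mono) (auto simp: dist_norm)
        also have "\<dots> < (C + 1) * \<delta>" using \<delta> by simp
        also have "\<dots> = e / 3" using C0 by (simp add: \<delta>_def field_simps)
        finally show ?thesis .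
      qed
      have close: "dist (T n x) (T n y) < e / 3" for n
      proof -
        have "norm (T n x - T n y) = norm (T n (x - y))" by (simp add: linear_diff[OF lin])
        also have "\<dots> \<le> C * norm (x - y)" by (rule nT)
        finally show ?thesis using Cy by (simp add: dist_norm norm_minus_commute)
      qed
      have "Cauchy (\<lambda>n. T n y)" using span[OF y(1)] by (rule convergent_Cauchy)
      then obtain N where N: "\<And>m n. m \<ge> N \<Longrightarrow> n \<ge> N \<Longrightarrow> dist (T m y) (T n y) < e / 3"
        using e by (metis metric_CauchyD zero_less_divide_iff zero_less_numeral)
      have "dist (T m x) (T n x) < e" if "m \<ge> N" "n \<ge> N" for m n
      proof -
        have "dist (T m x) (T n x) \<le> dist (T m x) (T m y) + dist (T m y) (T n y) + dist (T n x) (T n y)"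
          by (smt (verit) dist_commute dist_triangle)
        then show ?thesis using close[of m] close[of n] N[OF that] by simp
      qed
      then show "\<exists>M. \<forall>m\<ge>M. \<forall>n\<ge>M. dist (T m x) (T n x) < e" by blast
    qed
    then show ?thesis by (simp add: Cauchy_convergent_iff)
  qed
  define L where "L x = lim (\<lambda>n. T n x)" for x
  have L: "(\<lambda>n. T n x) \<longlonglongrightarrow> L x" for x
    using all unfolding L_def by (simp add: convergent_LIMSEQ_iff)
  have "bounded_linear L"
  proof (rule bounded_linear_intro[where K = C])
    fix x y
    have "(\<lambda>n. T n x + T n y) \<longlonglongrightarrow> L (x + y)"
      using L[of "x + y"] by (simp add: linear_add[OF lin])
    then show "L (x + y) = L x + L y"
      by (rule LIMSEQ_unique) (intro tendsto_add L)
  next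
    fix r x
    have "(\<lambda>n. r *\<^sub>R T n x) \<longlonglongrightarrow> L (r *\<^sub>R x)"
      using L[of "r *\<^sub>R x"] by (simp add: linear_scale[OF lin])
    then show "L (r *\<^sub>R x) = r *\<^sub>R L x"
      by (rule LIMSEQ_unique) (intro tendsto_intros L)
  next
    fix x
    show "norm (L x) \<le> norm x * C"
      by (rule tendsto_upperbound[OF tendsto_norm[OF L]]) (use nT in \<open>auto simp: mult.commute\<close>)
  qed
  then show ?thesis using L by blast
qed

section \<open>Regularisation by the Gaussian and convergence of the operators\<close>

lemma Hor_gauss_in_W:
  assumes "f \<in> Hor v \<omega>"
  shows "restr \<omega> (\<lambda>z. gauss z * f z) \<in> W v \<omega>"
proof -
  have "restr \<omega> (\<lambda>z. shift 0 gauss z * f z) \<in> W v \<omega>" using assms by (simp add: Hor_def)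
  then show ?thesis by (simp add: shift_def)
qed

theorem theorem7p6:
  fixes v :: "real \<Rightarrow> real" and \<omega> :: real
    and DA :: "'x::cbanach set" and A :: "'x \<Rightarrow> 'x"
    and \<Psi> :: "(complex \<Rightarrow> complex) \<Rightarrow> 'x \<Rightarrow> 'x"
    and f :: "complex \<Rightarrow> complex" and fs :: "nat \<Rightarrow> complex \<Rightarrow> complex"
    and D :: "(complex \<Rightarrow> complex) set"
  assumes "\<omega> \<ge> 0"
    and "strongly_admissible v"
    and "lin_op DA A"
    and "W_calculus v \<omega> DA A \<Psi>"
    and "f \<in> Hor v \<omega>"
    and "\<forall>n. fs n \<in> Hor v \<omega>"
    and "D \<subseteq> Hinf0_closed \<omega>"
    and "ample \<omega> \<Psi> D"
    and "\<forall>\<psi>\<in>D. \<forall>n. restr \<omega> (\<lambda>z. \<psi> z * (fs n z - f z)) \<in> W v \<omega>"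
    and "\<forall>\<psi>\<in>D. (\<lambda>n. Wnorm v \<omega> (restr \<omega> (\<lambda>z. \<psi> z * (fs n z - f z)))) \<longlonglongrightarrow> 0"
    and "\<forall>n. fA_dom \<omega> \<Psi> (fs n) = UNIV \<and> bounded_op (fA \<omega> \<Psi> (fs n))"
    and "\<exists>C. \<forall>n. onorm (fA \<omega> \<Psi> (fs n)) \<le> C"
  shows "fA_dom \<omega> \<Psi> f = UNIV \<and> bounded_op (fA \<omega> \<Psi> f) \<and>
         (\<forall>x. (\<lambda>n. fA \<omega> \<Psi> (fs n) x) \<longlonglongrightarrow> fA \<omega> \<Psi> f x)"
proof -
  note \<omega> = assms(1) and sv = assms(2) and lin = assms(3) and cal = assms(4)
  have v: "admissible v" using sv by (simp add: strongly_admissible_def)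
  define G where "G = \<Psi> (restr \<omega> gauss)"
  define H where "H h = \<Psi> (restr \<omega> (\<lambda>z. gauss z * h z))" for h
  define T where "T n = fA \<omega> \<Psi> (fs n)" for n
  have GW: "restr \<omega> gauss \<in> W v \<omega>" by (rule gauss_in_W[OF v \<omega>])
  have HW: "restr \<omega> (\<lambda>z. gauss z * f z) \<in> W v \<omega>" "restr \<omega> (\<lambda>z. gauss z * fs n z) \<in> W v \<omega>" for n
    using assms(5,6) Hor_gauss_in_W by blast+
  have Gbl: "bounded_linear G" and Hbl: "bounded_linear (H f)"
    using W_calculus_bounded_op[OF cal] GW HW by (auto simp: G_def H_def bounded_op_def)
  have Ginj: "x = y" if "G x = G y" for x y
  proof -
    have "G (x - y) = 0" using that bounded_linear.linear[OF Gbl] by (simp add: linear_diff)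
    then have "x - y = 0"
      unfolding G_def by (rule W_calculus_gauss_injective[OF \<omega> v lin cal])
    then show ?thesis by simp
  qed
  \<comment> \<open>Injectivity of \<open>G\<close> makes any solution the value selected by
    \<open>THE\<close>.\<close>
  have fA_eq: "fA \<omega> \<Psi> h x = y" if "G y = H h x" for h x y
    unfolding fA_def using that Ginj by (intro the_equality) (auto simp: G_def H_def)
  have GT: "G (T n x) = H (fs n) x" for n x
  proof -
    have "x \<in> fA_dom \<omega> \<Psi> (fs n)" using assms(11) by simp
    then obtain y where "G y = H (fs n) x" by (auto simp: fA_dom_def G_def H_def)
    then show ?thesis using fA_eq by (simp add: T_def)
  qed
  have Tbo: "bounded_op (T n)" for n using assms(11) by (simp add: T_def)
  then have Tbl: "bounded_linear (T n)" for n by (simp add: bounded_op_def)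
  obtain C where C: "\<And>n. onorm (T n) \<le> C" using assms(12) by (auto simp: T_def)
  \<comment> \<open>The \<open>span\<close> in the ampleness hypothesis is the real one. Each range
    is invariant under \<open>cscale\<close>, as the operators are complex linear, so it agrees with
    the complex span.\<close>
  define S where "S = (\<Union>\<psi>\<in>D. range (\<Psi> (restr \<omega> \<psi>)))"
  have S: "closure (span S) = UNIV" using assms(8) by (simp add: ample_def S_def)
  have key: "\<exists>y. (\<lambda>n. T n u) \<longlonglongrightarrow> y \<and> G y = H f u" if u: "u \<in> S" for u
  proof -
    obtain \<psi> x where \<psi>: "\<psi> \<in> D" and ux: "u = \<Psi> (restr \<omega> \<psi>) x" using u by (auto simp: S_def)
    have \<psi>W: "restr \<omega> \<psi> \<in> W v \<omega>"
      using Hinf0_closed_in_W[OF v \<omega>] assms(7) \<psi> by blast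
    define d where "d n = \<Psi> (restr \<omega> (\<lambda>z. \<psi> z * (fs n z - f z))) x" for n
    have dW: "restr \<omega> (\<lambda>z. \<psi> z * (fs n z - f z)) \<in> W v \<omega>" for n using assms(9) \<psi> by blast
    have d0: "d \<longlonglongrightarrow> 0"
      unfolding d_def using assms(10) \<psi> by (intro W_calculus_tendsto_0[OF cal dW]) blast
    \<comment> \<open>The product of the Gaussian, \<open>\<psi>\<close> and f_n - f is grouped in
      two ways, each time into two members of the algebra, so that multiplicativity applies to both
      groupings.\<close>
    have "G (d n) = H (fs n) u - H f u" for n
    proof -
      have dif: "restr \<omega> (\<lambda>z. gauss z * fs n z - gauss z * f z) \<in> W v \<omega>"
      proof -
        have "restr \<omega> (\<lambda>z. gauss z * fs n z - gauss z * f z) =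
            (\<lambda>z. restr \<omega> (\<lambda>z. gauss z * fs n z) z - restr \<omega> (\<lambda>z. gauss z * f z) z)"
          by (auto simp: restr_def)
        then show ?thesis using W_diff[OF sv \<omega> HW(2) HW(1)] by simp
      qed
      have "G (d n) = \<Psi> (restr \<omega> (\<lambda>z. gauss z * (\<psi> z * (fs n z - f z)))) x"
        unfolding G_def d_def by (rule W_calculus_mult[OF cal GW dW, symmetric])
      also have "(\<lambda>z. gauss z * (\<psi> z * (fs n z - f z))) = (\<lambda>z. (gauss z * fs n z - gauss z * f z) * \<psi> z)"
        by (auto simp: algebra_simps)
      also have "\<Psi> (restr \<omega> (\<lambda>z. (gauss z * fs n z - gauss z * f z) * \<psi> z)) x
          = \<Psi> (restr \<omega> (\<lambda>z. gauss z * fs n z - gauss z * f z)) u"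
        unfolding ux by (rule W_calculus_mult[OF cal dif \<psi>W])
      also have "\<dots> = H (fs n) u - H f u"
        unfolding H_def by (rule W_calculus_diff[OF cal dif HW(1)])
      finally show ?thesis .
    qed
    then have G0: "G (T n u - d n) = H f u" for n
      using bounded_linear.linear[OF Gbl] by (simp add: linear_diff GT)
    \<comment> \<open>Any index would do here: the right-hand side of \<open>G0\<close> is
      independent of n, hence so is T_n u - d_n by injectivity of \<open>G\<close>.\<close>
    define y where "y = T 0 u - d 0"
    have "T n u - d n = y" for n by (rule Ginj) (simp add: G0 y_def)
    then have "T n u = y + d n" for n by (metis add.commute diff_eq_eq)
    moreover have "(\<lambda>n. y + d n) \<longlonglongrightarrow> y + 0" by (intro tendsto_intros d0)
    ultimately have "(\<lambda>n. T n u) \<longlonglongrightarrow> y" by simp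
    then show ?thesis using G0[of 0] by (auto simp: y_def)
  qed
  obtain L where Lbl: "bounded_linear L" and L: "\<And>x. (\<lambda>n. T n x) \<longlonglongrightarrow> L x"
  proof -
    have "convergent (\<lambda>n. T n u)" if "u \<in> S" for u
      using key[OF that] by (auto simp: convergent_def)
    from uniformly_bounded_strong_limit[of T, OF Tbl C S this] show ?thesis using that by blast
  qed
  \<comment> \<open>On \<open>S\<close> the identity follows from \<open>key\<close> and uniqueness
    of limits; both sides are bounded operators, so it extends by density.\<close>
  have GL: "G (L x) = H f x" for x
  proof (rule bounded_linear_eq_on_dense_span[OF bounded_linear_compose[OF Gbl Lbl] Hbl S])
    fix u assume "u \<in> S"
    then show "G (L u) = H f u" using key[of u] LIMSEQ_unique[OF L] by blast
  qed
  have fL: "fA \<omega> \<Psi> f = L" using fA_eq[OF GL] by blast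
  have "fA_dom \<omega> \<Psi> f = UNIV" using GL by (auto simp: fA_dom_def G_def H_def)
  moreover have "bounded_op L"
    unfolding bounded_op_def
  proof (intro conjI allI Lbl)
    fix c x
    \<comment> \<open>Continuity of complex scalar multiplication lets complex homogeneity pass from
      the T_n to the limit.\<close>
    have "bounded_linear (cscale c :: 'x \<Rightarrow> 'x)"
    proof (rule bounded_linear_intro[where K = "cmod c"])
      show "cscale c (a *\<^sub>R y) = a *\<^sub>R cscale c y" for a and y :: 'x
        unfolding cscale_of_real[symmetric] cscale_cscale by (simp add: mult.commute)
    qed (auto simp: cscale_add_right norm_cscale mult.commute)
    then have "(\<lambda>n. cscale c (T n x)) \<longlonglongrightarrow> cscale c (L x)"
      by (rule bounded_linear.tendsto) (rule L)
    moreover have "T n (cscale c x) = cscale c (T n x)" for n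
      using Tbo by (simp add: bounded_op_def)
    ultimately show "L (cscale c x) = cscale c (L x)"
      using LIMSEQ_unique[OF L[of "cscale c x"]] by simp
  qed
  ultimately show ?thesis using L by (simp add: fL T_def)
qed

end
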